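(* Let $G$ be a compact abelian group with countable dual group $\widehat{G}$ and Haar probability measure $\mathbf{m}$, let $\Omega=\mathrm{Epi}(G)^{\mathbb{N}}$ with shift $\sigma$, let $\mu$ be a $\sigma$-invariant probability measure on $\Omega$, and let $S(\omega,x)=(\sigma\omega,\omega_0x)$ on $\Omega\times G$. Suppose that this skew product of epimorphisms is Fourier tight. If $\mu$ is (strongly) $\sigma$-mixing, then $\mu\otimes\mathbf{m}$ is (strongly) $S$-mixing.
   Context: $\mathrm{Epi}(G)$ is the semigroup of continuous surjective endomorphisms of $G$; every such map preserves $\mathbf{m}$. Elements of $\Omega=\mathrm{Epi}(G)^{\mathbb{N}}$ are sequences $\omega=(\omega_n)_{n\ge 0}$, and $\sigma((\omega_n)_{n\ge0})=(\omega_{n+1})_{n\ge0}$. $\Omega$ carries a $\sigma$-algebra for which $\sigma$ is measurable and the map $(\omega,x)\mapsto \omega_0x$ from $\Omega\times G$ to $G$ (with $G$ carrying its Borel $\sigma$-algebra) is measurable. The skew product transformation is $S:\Omega\times G\to\Omega\times G$, $S(\omega,x)=(\sigma\omega,\omega_0x)$; it preserves $\mu\otimes\mathbf{m}$. For an endomorphism $\tau$ of $G$, its adjoint $\tau^*:\widehat G\to\widehat G$ is $\tau^*(\gamma)=\gamma\circ\tau$; $1$ denotes the trivial character. The skew product is called Fourier tight if for $\mu$-almost every $\omega$, for any finite set $\Gamma\subset\widehat{G}$ there is an integer $m_0=m_0(\omega,\Gamma)$ such that for all $m\ge m_0$, $(\omega_{m-1}\omega_{m-2}\cdots\omega_1\omega_0)^*(\widehat{G}\setminus\{1\})\subset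 \widehat G\setminus\Gamma$. A $T$-invariant probability measure $\nu$ is $T$-mixing (strongly mixing) if $\lim_{n\to\infty}\int F\cdot (H\circ T^n)\,d\nu=\int F\,d\nu\int H\,d\nu$ for all $F,H\in L^2(\nu)$. *)

theory Defs
  imports "HOL-Probability.Probability_Measure"
begin

text \<open>The group \<open>G\<close> is written additively and is the whole type \<open>'a\<close>; its
  compactness appears as the hypothesis \<open>compact UNIV\<close>, and Hausdorffness as the class \<open>t2_space\<close>.\<close>

definition dual_group :: "('a::topological_ab_group_add \<Rightarrow> complex) set" where
  "dual_group = {\<gamma>. continuous_on UNIV \<gamma> \<and> (\<forall>x. norm (\<gamma> x) = 1) \<and>
                    (\<forall>x y. \<gamma> (x + y) = \<gamma> x * \<gamma> y)}"

definition trivial_character :: "'a::topological_ab_group_add \<Rightarrow> complex" where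
  "trivial_character = (\<lambda>_. 1)"

definition Epi :: "('a::topological_ab_group_add \<Rightarrow> 'a) set" where
  "Epi = {\<tau>. continuous_on UNIV \<tau> \<and> Modules.additive \<tau> \<and> surj \<tau>}"

definition adjoint_map :: "('a \<Rightarrow> 'a) \<Rightarrow> ('a \<Rightarrow> complex) \<Rightarrow> 'a \<Rightarrow> complex" where
  "adjoint_map \<tau> \<gamma> = \<gamma> \<circ> \<tau>"

text \<open>As usual, a Haar measure is a \<^emph>\<open>regular\<close> translation-invariant Borel measure; on a
  compact Hausdorff group the normalized one is unique.\<close>

definition haar_probability :: "'a::{topological_ab_group_add, t2_space} measure \<Rightarrow> bool" where
  "haar_probability m \<longleftrightarrow>
     prob_space m \<and> sets m = sets borel \<and>
     (\<forall>a. distr m m (\<lambda>x. a + x) = m) \<and>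
     (\<forall>A\<in>sets borel. emeasure m A = (INF U\<in>{U. open U \<and> A \<subseteq> U}. emeasure m U)) \<and>
     (\<forall>U. open U \<longrightarrow> emeasure m U = (SUP K\<in>{K. compact K \<and> K \<subseteq> U}. emeasure m K))"

definition seq_shift :: "(nat \<Rightarrow> 'b) \<Rightarrow> nat \<Rightarrow> 'b" where
  "seq_shift \<omega> = (\<lambda>n. \<omega> (Suc n))"

definition skew_product :: "(nat \<Rightarrow> 'a \<Rightarrow> 'a) \<times> 'a \<Rightarrow> (nat \<Rightarrow> 'a \<Rightarrow> 'a) \<times> 'a" where
  "skew_product = (\<lambda>(\<omega>, x). (seq_shift \<omega>, \<omega> 0 x))"

text \<open>\<open>comp_upto \<omega> m\<close> is the composition \<open>\<omega> (m - 1) \<circ> \<dots> \<circ> \<omega> 1 \<circ> \<omega> 0\<close>.\<close>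

primrec comp_upto :: "(nat \<Rightarrow> 'a \<Rightarrow> 'a) \<Rightarrow> nat \<Rightarrow> 'a \<Rightarrow> 'a" where
  "comp_upto \<omega> 0 = id"
| "comp_upto \<omega> (Suc m) = \<omega> m \<circ> comp_upto \<omega> m"

definition fourier_tight :: "(nat \<Rightarrow> 'a::topological_ab_group_add \<Rightarrow> 'a) measure \<Rightarrow> bool" where
  "fourier_tight \<mu> \<longleftrightarrow>
     (AE \<omega> in \<mu>. \<forall>\<Gamma>. finite \<Gamma> \<and> \<Gamma> \<subseteq> dual_group \<longrightarrow>
        (\<exists>m\<^sub>0. \<forall>m\<ge>m\<^sub>0. adjoint_map (comp_upto \<omega> m) ` (dual_group - {trivial_character})
                       \<subseteq> dual_group - \<Gamma>))"

definition invariant_probability :: "'b measure \<Rightarrow> ('b \<Rightarrow> 'b) \<Rightarrow> bool" where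
  "invariant_probability \<nu> T \<longleftrightarrow> prob_space \<nu> \<and> T \<in> measurable \<nu> \<nu> \<and> distr \<nu> \<nu> T = \<nu>"

definition in_L2 :: "'b measure \<Rightarrow> ('b \<Rightarrow> complex) \<Rightarrow> bool" where
  "in_L2 \<nu> F \<longleftrightarrow> F \<in> borel_measurable \<nu> \<and> integrable \<nu> (\<lambda>x. (norm (F x))\<^sup>2)"

definition strongly_mixing :: "'b measure \<Rightarrow> ('b \<Rightarrow> 'b) \<Rightarrow> bool" where
  "strongly_mixing \<nu> T \<longleftrightarrow> invariant_probability \<nu> T \<and>
     (\<forall>F H. in_L2 \<nu> F \<and> in_L2 \<nu> H \<longrightarrow>
        (\<lambda>n. \<integral>x. F x * H ((T ^^ n) x) \<partial>\<nu>) \<longlonglongrightarrow> (\<integral>x. F x \<partial>\<nu>) * (\<integral>x. H x \<partial>\<nu>))"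

end

theory Submission
  imports Defs "HOL-Analysis.Analysis"
begin

text \<open>For \<open>F = 1\<^sub>A \<otimes> \<gamma>\<close> and \<open>H = 1\<^sub>B \<otimes> \<delta>\<close> with characters \<open>\<gamma>\<close>, \<open>\<delta>\<close>, integrating \<open>F \<cdot> H \<circ> S\<^sup>n\<close> over the
  fibre gives \<open>\<integral> \<gamma> \<cdot> (\<delta> \<circ> \<omega>\<^bsub>n-1\<^esub> \<circ> \<dots> \<circ> \<omega>\<^sub>0) dm\<close>. If \<open>\<delta> = 1\<close> this is a constant and mixing of the base
  applies; otherwise Fourier tightness says that for almost every \<open>\<omega>\<close> the integrand is eventually
  a nontrivial character, so the correlations tend to \<open>0\<close>. The general case follows because such
  products span a dense subspace of \<open>L\<^sup>2\<close>.

  The density rests on the Peter--Weyl theorem for compact abelian groups, obtained here without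
  spectral theory: if \<open>h = h\<^sup>*\<close> is continuous, the convolution powers \<open>h\<^bsup>2n\<^esup>\<close>, divided by \<open>L\<^sup>n\<close> for the right \<open>L\<close>,
  converge uniformly to an idempotent \<open>q \<noteq> 0\<close>, and an idempotent that is minimal
  (which exists since \<open>\<parallel>q\<parallel>\<^sup>2\<close> drops by at least \<open>1\<close> along a descent) is a multiple of a character.\<close>

section \<open>Square-integrable functions and decay of correlations\<close>

text \<open>The argument works from compactness and the Hausdorff property rather than from a metric
  on the group, and this shapes it. Joint measurability and continuity of parametric integrals come
  from uniform closeness of sections over a compact factor, not from sequences. Continuous functions
  need not generate the Borel sets of such a space, so regularity of \<open>m\<close> carries
  statements about their integrals over to open sets; density in L^2 of the product is then a Dynkin
  argument on rectangles with open second side.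

  Peter--Weyl serves twice: besides density it yields that epimorphisms preserve \<open>m\<close>,
  since trigonometric polynomials determine the integral and a nontrivial character composed with a
  surjection stays nontrivial.

  Density is phrased as an induction principle: a property that survives linear combinations and L^2
  limits holds on all of L^2 once it holds for the products. Convergence of correlations is such a
  property in each argument because the error is bounded by L^2 norms uniformly in
  \<open>n\<close>.\<close>

definition sq_norm :: "'b measure \<Rightarrow> ('b \<Rightarrow> complex) \<Rightarrow> real" where
  "sq_norm M f = (\<integral>x. (norm (f x))\<^sup>2 \<partial>M)"

lemma sq_norm_nonneg: "0 \<le> sq_norm M f"
  by (simp add: sq_norm_def)

lemma in_L2_mult_integrable:
  assumes "in_L2 M f" "in_L2 M g"
  shows "integrable M (\<lambda>x. f x * g x)"
proof (rule Bochner_Integration.integrable_bound)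
  show "integrable M (\<lambda>x. (norm (f x))\<^sup>2 + (norm (g x))\<^sup>2)"
    using assms by (simp add: in_L2_def)
  show "(\<lambda>x. f x * g x) \<in> borel_measurable M"
    using assms by (auto simp: in_L2_def)
  have "norm (f x * g x) \<le> norm ((norm (f x))\<^sup>2 + (norm (g x))\<^sup>2)" for x
  proof -
    have "0 \<le> norm (f x) * norm (g x)" by simp
    with sum_squares_bound[of "norm (f x)" "norm (g x)"]
    have "norm (f x) * norm (g x) \<le> (norm (f x))\<^sup>2 + (norm (g x))\<^sup>2" by linarith
    then show ?thesis by (simp add: norm_mult)
  qed
  then show "AE x in M. norm (f x * g x) \<le> norm ((norm (f x))\<^sup>2 + (norm (g x))\<^sup>2)"
    by simp
qed

lemma in_L2_add:
  assumes "in_L2 M f" "in_L2 M g"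
  shows "in_L2 M (\<lambda>x. f x + g x)"
  unfolding in_L2_def
proof (rule conjI, goal_cases)
  case 1
  show "(\<lambda>x. f x + g x) \<in> borel_measurable M"
    using assms by (auto simp: in_L2_def)
next
  case 2
  show ?case
  proof (rule Bochner_Integration.integrable_bound)
    have 1: "(\<lambda>x. f x + g x) \<in> borel_measurable M"
      using assms by (auto simp: in_L2_def)
    show "(\<lambda>x. (norm (f x + g x))\<^sup>2) \<in> borel_measurable M"
      by (intro borel_measurable_power measurable_compose[OF 1 borel_measurable_norm])
    show "integrable M (\<lambda>x. 2 * (norm (f x))\<^sup>2 + 2 * (norm (g x))\<^sup>2)"
      using assms by (simp add: in_L2_def)
    have "(norm (f x + g x))\<^sup>2 \<le> 2 * (norm (f x))\<^sup>2 + 2 * (norm (g x))\<^sup>2" for x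
    proof -
      have "(norm (f x + g x))\<^sup>2 \<le> (norm (f x) + norm (g x))\<^sup>2"
        by (intro power_mono norm_triangle_ineq norm_ge_zero)
      also have "\<dots> = (norm (f x))\<^sup>2 + (norm (g x))\<^sup>2 + 2 * norm (f x) * norm (g x)"
        by (rule power2_sum)
      finally show ?thesis
        using sum_squares_bound[of "norm (f x)" "norm (g x)"] by linarith
    qed
    then show "AE x in M. norm ((norm (f x + g x))\<^sup>2) \<le> norm (2 * (norm (f x))\<^sup>2 + 2 * (norm (g x))\<^sup>2)"
      by (intro AE_I2) simp
  qed
qed

lemma in_L2_cmult: "in_L2 M f \<Longrightarrow> in_L2 M (\<lambda>x. c * f x)"
  by (auto simp: in_L2_def norm_mult power_mult_distrib)

lemma in_L2_diff: "in_L2 M f \<Longrightarrow> in_L2 M g \<Longrightarrow> in_L2 M (\<lambda>x. f x - g x)"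
  using in_L2_add[of M f "\<lambda>x. -1 * g x"] in_L2_cmult[of M g "-1"] by simp

lemma in_L2_bounded:
  assumes "finite_measure M" "f \<in> borel_measurable M" "\<And>x. x \<in> space M \<Longrightarrow> norm (f x) \<le> B"
  shows "in_L2 M f"
  unfolding in_L2_def
proof (rule conjI[OF assms(2) finite_measure.integrable_const_bound[OF assms(1), where B="B\<^sup>2"]])
  show "AE x in M. norm ((norm (f x))\<^sup>2) \<le> B\<^sup>2"
    using assms(3) by (auto intro!: AE_I2 power_mono)
  show "(\<lambda>x. (norm (f x))\<^sup>2) \<in> borel_measurable M"
    by (intro borel_measurable_power measurable_compose[OF assms(2) borel_measurable_norm])
qed

lemma in_L2_integrable:
  assumes "prob_space M" "in_L2 M f"
  shows "integrable M f"
proof -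
  interpret prob_space M by fact
  have "in_L2 M (\<lambda>_. 1)"
    by (rule in_L2_bounded[where B=1]) (auto intro: finite_measure_axioms)
  from in_L2_mult_integrable[OF assms(2) this] show ?thesis by simp
qed

text \<open>The free weights \<open>s\<close> and \<open>t\<close> in
  \<open>2ab \<le> a^2 + b^2\<close> let one pointwise estimate settle both the degenerate and the
  regular case.\<close>

lemma L2_Cauchy_Schwarz:
  assumes f: "in_L2 M f" and g: "in_L2 M g"
  shows "norm (\<integral>x. f x * g x \<partial>M) \<le> sqrt (sq_norm M f) * sqrt (sq_norm M g)"
proof -
  define c where "c = norm (\<integral>x. f x * g x \<partial>M)"
  define A where "A = sq_norm M f"
  define B where "B = sq_norm M g"
  have nn: "0 \<le> A" "0 \<le> B" "0 \<le> c" by (simp_all add: A_def B_def c_def sq_norm_nonneg)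
  have *: "2 * (s * t) * c \<le> s\<^sup>2 * A + t\<^sup>2 * B" if "0 \<le> s" "0 \<le> t" for s t
  proof -
    have int: "integrable M (\<lambda>x. (norm (f x))\<^sup>2)" "integrable M (\<lambda>x. (norm (g x))\<^sup>2)"
      using f g by (auto simp: in_L2_def)
    have "c \<le> (\<integral>x. norm (f x * g x) \<partial>M)"
      unfolding c_def by (rule integral_norm_bound)
    then have "2 * (s * t) * c \<le> (\<integral>x. 2 * (s * t) * norm (f x * g x) \<partial>M)"
      using that by (simp add: mult_left_mono)
    also have "\<dots> \<le> (\<integral>x. s\<^sup>2 * (norm (f x))\<^sup>2 + t\<^sup>2 * (norm (g x))\<^sup>2 \<partial>M)"
    proof (rule integral_mono)
      show "integrable M (\<lambda>x. 2 * (s * t) * norm (f x * g x))"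
        using in_L2_mult_integrable[OF f g] by auto
      show "integrable M (\<lambda>x. s\<^sup>2 * (norm (f x))\<^sup>2 + t\<^sup>2 * (norm (g x))\<^sup>2)"
        using int by auto
      show "2 * (s * t) * norm (f x * g x) \<le> s\<^sup>2 * (norm (f x))\<^sup>2 + t\<^sup>2 * (norm (g x))\<^sup>2" for x
        using sum_squares_bound[of "s * norm (f x)" "t * norm (g x)"]
        by (simp add: norm_mult power_mult_distrib mult_ac)
    qed
    also have "\<dots> = s\<^sup>2 * A + t\<^sup>2 * B"
      using int by (simp add: A_def B_def sq_norm_def)
    finally show ?thesis .
  qed
  have "c \<le> sqrt A * sqrt B"
  proof (cases "A = 0 \<or> B = 0")
    case True
    have "c = 0"
    proof (rule ccontr)
      assume "c \<noteq> 0"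
      then have "0 < c" using nn by simp
      from True show False
      proof
        assume "A = 0"
        \<comment> \<open>This weight makes the left side \<open>2 * (B + 1)\<close>, while the
          right side is only \<open>B\<close>.\<close>
        with *[of "(B + 1) / c" 1] \<open>0 < c\<close> nn show False by simp
      next
        assume "B = 0"
        with *[of 1 "(A + 1) / c"] \<open>0 < c\<close> nn show False by simp
      qed
    qed
    then show ?thesis using nn by simp
  next
    case False
    then have pos: "0 < A" "0 < B" using nn by auto
    \<comment> \<open>Balanced weights: both terms on the right become \<open>A * B\<close>, and
      cancelling \<open>2 * (sqrt B * sqrt A)\<close> leaves the claim.\<close>
    have "2 * (sqrt B * sqrt A) * c \<le> (sqrt B)\<^sup>2 * A + (sqrt A)\<^sup>2 * B"
      by (rule *) (use nn in auto)
    also have "\<dots> = 2 * (sqrt B * sqrt A) * (sqrt A * sqrt B)"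
      using nn real_sqrt_pow2[of A] real_sqrt_pow2[of B]
      by (simp add: power2_eq_square algebra_simps)
    finally show ?thesis
      using pos by simp
  qed
  then show ?thesis by (simp add: c_def A_def B_def)
qed

lemma (in finite_measure) sq_norm_le_bound:
  assumes "f \<in> borel_measurable M" "\<And>x. x \<in> space M \<Longrightarrow> norm (f x) \<le> B"
  shows "sq_norm M f \<le> B\<^sup>2 * measure M (space M)"
proof -
  have "sq_norm M f \<le> (\<integral>x. B\<^sup>2 \<partial>M)"
    unfolding sq_norm_def
  proof (rule integral_mono)
    show "integrable M (\<lambda>x. (norm (f x))\<^sup>2)"
      using in_L2_bounded[OF finite_measure_axioms assms] by (simp add: in_L2_def)
  qed (use assms(2) in \<open>auto intro!: power_mono\<close>)
  then show ?thesis by (simp add: mult.commute)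
qed

text \<open>Density of simple functions as an induction rule. The last three premises on
  \<open>P\<close> describe a closed subspace of L^2; \<open>lim\<close> asks for an approximant for
  each \<open>e\<close> instead of a sequence, which is the form that error estimates
  deliver.\<close>

lemma L2_induct_indicator:
  assumes "prob_space M" and F: "in_L2 M F"
    and indicator: "\<And>C. C \<in> sets M \<Longrightarrow> P (indicator C :: _ \<Rightarrow> complex)"
    and add: "\<And>f g. in_L2 M f \<Longrightarrow> in_L2 M g \<Longrightarrow> P f \<Longrightarrow> P g \<Longrightarrow> P (\<lambda>x. f x + g x)"
    and cmult: "\<And>f c. in_L2 M f \<Longrightarrow> P f \<Longrightarrow> P (\<lambda>x. c * f x)"
    and lim: "\<And>f. in_L2 M f \<Longrightarrow>
      (\<And>e. 0 < e \<Longrightarrow> \<exists>g. in_L2 M g \<and> P g \<and> sq_norm M (\<lambda>x. f x - g x) < e) \<Longrightarrow> P f"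
  shows "P F"
proof (rule lim[OF F])
  interpret prob_space M by fact
  fix e :: real
  assume "0 < e"
  have Fm: "F \<in> borel_measurable M" and Fi: "integrable M (\<lambda>x. (norm (F x))\<^sup>2)"
    using F by (auto simp: in_L2_def)
  obtain s where s: "\<And>i. simple_function M (s i)"
    "\<And>x. x \<in> space M \<Longrightarrow> (\<lambda>i. s i x) \<longlonglongrightarrow> F x"
    "\<And>i x. x \<in> space M \<Longrightarrow> norm (s i x) \<le> 2 * norm (F x)"
    using borel_measurable_implies_sequence_metric[OF Fm, of 0] unfolding dist_norm diff_zero by metis
  have sm: "s i \<in> borel_measurable M" for i
    by (rule borel_measurable_simple_function[OF s(1)])
  have "(\<lambda>i. \<integral>x. (norm (F x - s i x))\<^sup>2 \<partial>M) \<longlonglongrightarrow> (\<integral>x. 0 \<partial>M)"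
  \<comment> \<open>By \<open>s(3)\<close> the difference is at most three times
    \<open>norm (F x)\<close>, hence the factor 9.\<close>
  proof (rule integral_dominated_convergence[where w="\<lambda>x. 9 * (norm (F x))\<^sup>2"])
    show "integrable M (\<lambda>x. 9 * (norm (F x))\<^sup>2)" using Fi by simp
    show "(\<lambda>x. (norm (F x - s i x))\<^sup>2) \<in> borel_measurable M" for i
      using Fm sm[of i] by measurable
    show "AE x in M. (\<lambda>i. (norm (F x - s i x))\<^sup>2) \<longlonglongrightarrow> 0"
    proof (intro AE_I2)
      fix x
      assume "x \<in> space M"
      then have "(\<lambda>i. (norm (F x - s i x))\<^sup>2) \<longlonglongrightarrow> (norm (F x - F x))\<^sup>2"
        by (intro tendsto_intros s(2))
      then show "(\<lambda>i. (norm (F x - s i x))\<^sup>2) \<longlonglongrightarrow> 0" by simp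
    qed
    show "AE x in M. norm ((norm (F x - s i x))\<^sup>2) \<le> 9 * (norm (F x))\<^sup>2" for i
    proof (intro AE_I2)
      fix x
      assume "x \<in> space M"
      then have "norm (F x - s i x) \<le> 3 * norm (F x)"
        using s(3)[of x i] norm_triangle_ineq4[of "F x" "s i x"] by simp
      then have "(norm (F x - s i x))\<^sup>2 \<le> (3 * norm (F x))\<^sup>2" by (intro power_mono) auto
      then show "norm ((norm (F x - s i x))\<^sup>2) \<le> 9 * (norm (F x))\<^sup>2" by (simp add: power_mult_distrib)
    qed
  qed simp
  then have "\<forall>\<^sub>F i in sequentially. (\<integral>x. (norm (F x - s i x))\<^sup>2 \<partial>M) < e"
    using \<open>0 < e\<close> by (intro order_tendstoD(2)) auto
  then obtain i where i: "(\<integral>x. (norm (F x - s i x))\<^sup>2 \<partial>M) < e"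
    by (meson eventually_happens' sequentially_bot)
  define V where "V y = s i -` {y} \<inter> space M" for y
  have V: "V y \<in> sets M" for y
    unfolding V_def using simple_functionD(2)[OF s(1)] .
  have ind: "in_L2 M (indicator (V y))" for y
    using V by (intro in_L2_bounded[where B=1]) (auto intro: finite_measure_axioms simp: indicator_def)
  have "in_L2 M (\<lambda>x. \<Sum>y\<in>Y. y * indicator (V y) x) \<and> P (\<lambda>x. \<Sum>y\<in>Y. y * indicator (V y) x)"
    if "finite Y" for Y
    using that
  proof (induction Y rule: finite_induct)
    case empty
    have "in_L2 M (\<lambda>_. 0)" using in_L2_cmult[OF ind, of 0] by simp
    \<comment> \<open>The premises offer no zero function outright; it is obtained as 0 times an
      indicator.\<close>
    moreover have "P (\<lambda>_. 0)" using cmult[OF ind indicator[OF V], of 0] by simp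
    ultimately show ?case by simp
  next
    case (insert y Y)
    show ?case
      unfolding sum.insert[OF insert.hyps]
      by (intro conjI in_L2_add add in_L2_cmult ind cmult indicator V
          conjunct1[OF insert.IH] conjunct2[OF insert.IH])
  qed
  then have Q: "in_L2 M (\<lambda>x. \<Sum>y\<in>s i ` space M. y * indicator (V y) x)"
    "P (\<lambda>x. \<Sum>y\<in>s i ` space M. y * indicator (V y) x)"
    using simple_functionD(1)[OF s(1)] by blast+
  have "sq_norm M (\<lambda>x. F x - (\<Sum>y\<in>s i ` space M. y * indicator (V y) x)) =
      (\<integral>x. (norm (F x - s i x))\<^sup>2 \<partial>M)"
    unfolding sq_norm_def
  proof (rule Bochner_Integration.integral_cong[OF refl])
    fix x
    assume "x \<in> space M"
    have eq: "s i x = (\<Sum>y\<in>s i ` space M. y * indicator (V y) x)"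
      by (subst simple_function_indicator_representation_banach[OF s(1) \<open>x \<in> space M\<close>])
         (auto simp: V_def indicator_def scaleR_conv_of_real intro!: sum.cong)
    show "(norm (F x - (\<Sum>y\<in>s i ` space M. y * indicator (V y) x)))\<^sup>2 = (norm (F x - s i x))\<^sup>2"
      by (simp only: eq[symmetric])
  qed
  with Q i show "\<exists>g. in_L2 M g \<and> P g \<and> sq_norm M (\<lambda>x. F x - g x) < e" by auto
qed

lemma invariant_funpow:
  assumes "invariant_probability M T"
  shows "T ^^ n \<in> measurable M M" "distr M M (T ^^ n) = M"
proof -
  have T: "T \<in> measurable M M" "distr M M T = M" using assms by (auto simp: invariant_probability_def)
  have "T ^^ n \<in> measurable M M \<and> distr M M (T ^^ n) = M"
  proof (induction n)
    case 0
    then show ?case by (simp add: distr_id2 id_def)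
  next
    case (Suc n)
    then have "distr M M (T ^^ Suc n) = M"
      using distr_distr[OF T(1), of "T ^^ n" M] T(2) by simp
    moreover have "T ^^ Suc n \<in> measurable M M"
      using measurable_comp[OF conjunct1[OF Suc] T(1)] by simp
    ultimately show ?case by blast
  qed
  then show "T ^^ n \<in> measurable M M" "distr M M (T ^^ n) = M" by auto
qed

lemma invariant_in_L2:
  assumes T: "invariant_probability M T" and H: "in_L2 M H"
  shows "in_L2 M (\<lambda>x. H ((T ^^ n) x))" "sq_norm M (\<lambda>x. H ((T ^^ n) x)) = sq_norm M H"
proof -
  note inv = invariant_funpow[OF T, of n]
  have Hm: "H \<in> borel_measurable M" and Hi: "integrable M (\<lambda>x. (norm (H x))\<^sup>2)"
    using H by (auto simp: in_L2_def)
  have "integrable M (\<lambda>x. (norm (H ((T ^^ n) x)))\<^sup>2)"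
    using integrable_distr[OF inv(1), of "\<lambda>x. (norm (H x))\<^sup>2"] Hi by (simp add: inv(2))
  then show "in_L2 M (\<lambda>x. H ((T ^^ n) x))"
    using measurable_compose[OF inv(1) Hm] by (simp add: in_L2_def)
  show "sq_norm M (\<lambda>x. H ((T ^^ n) x)) = sq_norm M H"
    using integral_distr[OF inv(1) borel_measurable_integrable[OF Hi]] by (simp add: sq_norm_def inv(2))
qed

lemma L2_integral_bound:
  assumes "prob_space M" "in_L2 M f"
  shows "norm (\<integral>x. f x \<partial>M) \<le> sqrt (sq_norm M f)"
proof -
  interpret prob_space M by fact
  have 1: "in_L2 M (\<lambda>_. 1)"
    by (rule in_L2_bounded[where B=1]) (auto intro: finite_measure_axioms)
  from L2_Cauchy_Schwarz[OF assms(2) 1] show ?thesis by (simp add: sq_norm_def prob_space)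
qed

text \<open>Exchange of limits, with an error uniform in \<open>n\<close>. The limit
  \<open>l'\<close> changes with the approximating sequence, so deviations from the limits are
  compared instead of the sequences themselves.\<close>

lemma LIMSEQ_approx:
  fixes a :: "nat \<Rightarrow> complex"
  assumes "\<And>e. 0 < e \<Longrightarrow> \<exists>b l'. b \<longlonglongrightarrow> l' \<and> (\<forall>n. norm ((a n - l) - (b n - l')) \<le> e)"
  shows "a \<longlonglongrightarrow> l"
proof (rule LIMSEQ_I)
  fix e :: real
  assume "0 < e"
  then obtain b l' where b: "b \<longlonglongrightarrow> l'" "\<And>n. norm ((a n - l) - (b n - l')) \<le> e / 2"
    using assms[of "e / 2"] by auto
  obtain N where N: "\<And>n. N \<le> n \<Longrightarrow> norm (b n - l') < e / 2"
    using LIMSEQ_D[OF b(1), of "e / 2"] \<open>0 < e\<close> by auto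
  have "norm (a n - l) < e" if "N \<le> n" for n
    using norm_triangle_ineq[of "(a n - l) - (b n - l')" "b n - l'"] b(2)[of n] N[OF that] by simp
  then show "\<exists>N. \<forall>n\<ge>N. norm (a n - l) < e" by blast
qed

text \<open>Supplies the tolerance for the limit rules below, where the error is twice a product of
  norms. The summand 1 in \<open>?h\<close> keeps the divisor positive when \<open>H\<close> has
  norm 0.\<close>

lemma sqrt_product_small:
  assumes "0 < e"
  shows "\<exists>d>0. \<forall>s. s < d \<longrightarrow> 2 * sqrt s * sqrt (sq_norm M H) \<le> e"
proof -
  let ?h = "2 * sqrt (sq_norm M H) + 1"
  have "0 \<le> sqrt (sq_norm M H)" by (simp add: sq_norm_nonneg)
  then have h: "0 < ?h" by linarith
  have "2 * sqrt s * sqrt (sq_norm M H) \<le> e" if "s < (e / ?h)\<^sup>2" for s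
  proof -
    have "sqrt s \<le> e / ?h"
      using that assms h by (intro real_le_lsqrt) auto
    then have "sqrt s * (2 * sqrt (sq_norm M H)) \<le> (e / ?h) * (2 * sqrt (sq_norm M H))"
      using sq_norm_nonneg[of M H] by (intro mult_right_mono) auto
    also have "\<dots> \<le> (e / ?h) * ?h" using assms h by (intro mult_left_mono) auto
    also have "\<dots> = e" using h by simp
    finally show ?thesis by (simp add: mult_ac)
  qed
  moreover have "0 < (e / ?h)\<^sup>2" using assms h by simp
  ultimately show ?thesis by blast
qed

section \<open>Correlations under a measure-preserving map\<close>

definition correlations_decay :: "'b measure \<Rightarrow> ('b \<Rightarrow> 'b) \<Rightarrow> ('b \<Rightarrow> complex) \<Rightarrow> ('b \<Rightarrow> complex) \<Rightarrow> bool" where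
  "correlations_decay M T F H \<longleftrightarrow>
     (\<lambda>n. \<integral>x. F x * H ((T ^^ n) x) \<partial>M) \<longlonglongrightarrow> (\<integral>x. F x \<partial>M) * (\<integral>x. H x \<partial>M)"

context
  fixes M :: "'b measure" and T
  assumes inv: "invariant_probability M T"
begin

interpretation prob_space M
  using inv by (simp add: invariant_probability_def)

lemma correlation_integrable: "in_L2 M F \<Longrightarrow> in_L2 M H \<Longrightarrow> integrable M (\<lambda>x. F x * H ((T ^^ n) x))"
  by (intro in_L2_mult_integrable invariant_in_L2(1)[OF inv])

lemma decay_add_left:
  assumes "in_L2 M f" "in_L2 M g" "in_L2 M H" "correlations_decay M T f H" "correlations_decay M T g H"
  shows "correlations_decay M T (\<lambda>x. f x + g x) H"
  using tendsto_add[OF assms(4,5)[unfolded correlations_decay_def]] assms(1-3)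
  by (simp add: correlations_decay_def distrib_right correlation_integrable in_L2_integrable[OF prob_space_axioms])

lemma decay_add_right:
  assumes "in_L2 M f" "in_L2 M g" "in_L2 M F" "correlations_decay M T F f" "correlations_decay M T F g"
  shows "correlations_decay M T F (\<lambda>x. f x + g x)"
  using tendsto_add[OF assms(4,5)[unfolded correlations_decay_def]] assms(1-3)
  by (simp add: correlations_decay_def distrib_left correlation_integrable in_L2_integrable[OF prob_space_axioms])

lemma decay_cmult_left: "correlations_decay M T f H \<Longrightarrow> correlations_decay M T (\<lambda>x. c * f x) H"
  unfolding correlations_decay_def by (drule tendsto_mult_left[where c=c]) (simp add: mult.assoc)

lemma decay_cmult_right: "correlations_decay M T F f \<Longrightarrow> correlations_decay M T F (\<lambda>x. c * f x)"
  unfolding correlations_decay_def by (drule tendsto_mult_left[where c=c]) (simp add: mult.left_commute)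

text \<open>Composition with \<open>T ^^ n\<close> preserves the L^2 norm, so Cauchy--Schwarz bounds
  both terms by the same product. Independence of \<open>n\<close> is what makes the convergence
  stable under L^2 limits.\<close>

lemma correlation_bound:
  assumes F: "in_L2 M F" and H: "in_L2 M H"
  shows "norm ((\<integral>x. F x * H ((T ^^ n) x) \<partial>M) - (\<integral>x. F x \<partial>M) * (\<integral>x. H x \<partial>M))
    \<le> 2 * sqrt (sq_norm M F) * sqrt (sq_norm M H)"
proof -
  have "norm (\<integral>x. F x * H ((T ^^ n) x) \<partial>M) \<le> sqrt (sq_norm M F) * sqrt (sq_norm M H)"
    using L2_Cauchy_Schwarz[OF F invariant_in_L2(1)[OF inv H, of n]] by (simp add: invariant_in_L2(2)[OF inv H])
  moreover have "norm ((\<integral>x. F x \<partial>M) * (\<integral>x. H x \<partial>M)) \<le> sqrt (sq_norm M F) * sqrt (sq_norm M H)"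
    unfolding norm_mult
    by (intro mult_mono L2_integral_bound F H prob_space_axioms) (auto simp: sq_norm_nonneg)
  ultimately show ?thesis
    using norm_triangle_ineq4[of "\<integral>x. F x * H ((T ^^ n) x) \<partial>M" "(\<integral>x. F x \<partial>M) * (\<integral>x. H x \<partial>M)"] by linarith
qed

lemma decay_lim_left:
  assumes F: "in_L2 M F" and H: "in_L2 M H"
    and ap: "\<And>e. 0 < e \<Longrightarrow> \<exists>g. in_L2 M g \<and> correlations_decay M T g H \<and> sq_norm M (\<lambda>x. F x - g x) < e"
  shows "correlations_decay M T F H"
  unfolding correlations_decay_def
proof (rule LIMSEQ_approx)
  fix e :: real
  assume "0 < e"
  then obtain d where d: "0 < d" "\<And>s. s < d \<Longrightarrow> 2 * sqrt s * sqrt (sq_norm M H) \<le> e"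
    using sqrt_product_small by blast
  obtain g where g: "in_L2 M g" "correlations_decay M T g H" "sq_norm M (\<lambda>x. F x - g x) < d"
    using ap[OF d(1)] by blast
  let ?c = "\<lambda>F n. (\<integral>x. F x * H ((T ^^ n) x) \<partial>M) - (\<integral>x. F x \<partial>M) * (\<integral>x. H x \<partial>M)"
  \<comment> \<open>The deviation from the product of integrals is linear in \<open>F\<close>, so
    the bound applies to the difference.\<close>
  have "?c F n - ?c g n = ?c (\<lambda>x. F x - g x) n" for n
    using F g(1) H
    by (simp add: left_diff_distrib correlation_integrable in_L2_integrable[OF prob_space_axioms])
  then have "norm (?c F n - ?c g n) \<le> e" for n
    using correlation_bound[OF in_L2_diff[OF F g(1)] H, of n] d(2)[OF g(3)] by simp
  with g(2) show "\<exists>b l'. b \<longlonglongrightarrow> l' \<and>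
      (\<forall>n. norm (((\<integral>x. F x * H ((T ^^ n) x) \<partial>M) - (\<integral>x. F x \<partial>M) * (\<integral>x. H x \<partial>M)) - (b n - l')) \<le> e)"
    unfolding correlations_decay_def by blast
qed

lemma decay_lim_right:
  assumes F: "in_L2 M F" and H: "in_L2 M H"
    and ap: "\<And>e. 0 < e \<Longrightarrow> \<exists>g. in_L2 M g \<and> correlations_decay M T F g \<and> sq_norm M (\<lambda>x. H x - g x) < e"
  shows "correlations_decay M T F H"
  unfolding correlations_decay_def
proof (rule LIMSEQ_approx)
  fix e :: real
  assume "0 < e"
  then obtain d where d: "0 < d" "\<And>s. s < d \<Longrightarrow> 2 * sqrt s * sqrt (sq_norm M F) \<le> e"
    using sqrt_product_small by blast
  obtain g where g: "in_L2 M g" "correlations_decay M T F g" "sq_norm M (\<lambda>x. H x - g x) < d"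
    using ap[OF d(1)] by blast
  let ?c = "\<lambda>H n. (\<integral>x. F x * H ((T ^^ n) x) \<partial>M) - (\<integral>x. F x \<partial>M) * (\<integral>x. H x \<partial>M)"
  have "?c H n - ?c g n = ?c (\<lambda>x. H x - g x) n" for n
    using F g(1) H
    by (simp add: right_diff_distrib correlation_integrable in_L2_integrable[OF prob_space_axioms])
  then have "norm (?c H n - ?c g n) \<le> e" for n
    using correlation_bound[OF F in_L2_diff[OF H g(1)], of n] d(2)[OF g(3)] by (simp add: mult_ac)
  with g(2) show "\<exists>b l'. b \<longlonglongrightarrow> l' \<and>
      (\<forall>n. norm (((\<integral>x. F x * H ((T ^^ n) x) \<partial>M) - (\<integral>x. F x \<partial>M) * (\<integral>x. H x \<partial>M)) - (b n - l')) \<le> e)"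
    unfolding correlations_decay_def by blast
qed

end

section \<open>Convolution on a compact abelian group\<close>

text \<open>Without second countability the Borel sets of a product space need not lie in the product
  \<open>\<sigma>\<close>-algebra, so measurability of \<open>F\<close> is not automatic; compactness supplies uniform
  approximations that depend on the first coordinate through a finite Borel partition only.\<close>

lemma borel_measurable_pair_continuous:
  fixes F :: "'a::topological_space \<times> 'b::topological_space \<Rightarrow> complex"
  assumes F: "continuous_on UNIV F"
    and cpt: "compact (UNIV :: 'a set)" "compact (UNIV :: 'b set)"
  shows "F \<in> borel_measurable (borel \<Otimes>\<^sub>M borel)"
proof -
  have approx: "\<exists>F'. F' \<in> borel_measurable (borel \<Otimes>\<^sub>M borel) \<and> (\<forall>z. dist (F' z) (F z) \<le> e)"
    if "0 < e" for e
  proof -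
    have "\<exists>U. y \<in> U \<and> open U \<and> (\<forall>x\<in>U. \<forall>z. dist (F (x, z)) (F (y, z)) \<le> e)" for y
      using continuous_on_prod_compactE[of UNIV UNIV F y e] F cpt(2) that
      by (metis UNIV_I UNIV_Times_UNIV Int_UNIV_right)
    then obtain U where U: "\<And>y. y \<in> U y" "\<And>y. open (U y)"
      "\<And>x y z. x \<in> U y \<Longrightarrow> dist (F (x, z)) (F (y, z)) \<le> e"
      by metis
    have "UNIV \<subseteq> (\<Union>y\<in>UNIV. U y)" using U(1) by blast
    then obtain T where T: "finite T" "UNIV \<subseteq> (\<Union>y\<in>T. U y)"
      using compactE_image[OF cpt(1), of UNIV U] U(2) by metis
    have "\<exists>F'. F' \<in> borel_measurable (borel \<Otimes>\<^sub>M borel) \<and>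
            (\<forall>x\<in>(\<Union>y\<in>T. U y). \<forall>z. dist (F' (x, z)) (F (x, z)) \<le> e)"
      using T(1)
    proof (induction T rule: finite_induct)
      case empty
      then show ?case by (intro exI[of _ "\<lambda>_. 0"]) auto
    next
      case (insert y T)
      then obtain F' where F': "F' \<in> borel_measurable (borel \<Otimes>\<^sub>M borel)"
        "\<And>x z. x \<in> (\<Union>y\<in>T. U y) \<Longrightarrow> dist (F' (x, z)) (F (x, z)) \<le> e" by blast
      have "continuous_on UNIV (\<lambda>z. F (y, z))"
        by (rule continuous_on_compose2[OF F]) (auto intro!: continuous_intros)
      then have [measurable]: "(\<lambda>z. F (y, z)) \<in> borel_measurable borel"
        by (rule borel_measurable_continuous_onI)
      have [measurable]: "U y \<in> sets borel" using U(2) by simp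
      note F'(1)[measurable]
      \<comment> \<open>The newest neighbourhood overrides the earlier choices, which turns the
        finite open cover into a Borel partition.\<close>
      have "(\<lambda>p. if fst p \<in> U y then F (y, snd p) else F' p) \<in> borel_measurable (borel \<Otimes>\<^sub>M borel)"
        by measurable
      moreover have "dist (if x \<in> U y then F (y, z) else F' (x, z)) (F (x, z)) \<le> e"
        if "x \<in> (\<Union>y\<in>insert y T. U y)" for x z
        using F'(2)[of x z] U(3)[of x y z] that by (auto simp: dist_commute)
      ultimately show ?case
        by (intro exI[of _ "\<lambda>p. if fst p \<in> U y then F (y, snd p) else F' p"]) (simp only: fst_conv snd_conv, blast)
    qed
    with T(2) show ?thesis by (metis UNIV_I subsetD surj_pair)
  qed
  have "\<forall>n. \<exists>F'. F' \<in> borel_measurable (borel \<Otimes>\<^sub>M borel) \<and> (\<forall>z. dist (F' z) (F z) \<le> 1 / real (Suc n))"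
    by (intro allI approx) simp
  then obtain Fs where Fs: "\<And>n. Fs n \<in> borel_measurable (borel \<Otimes>\<^sub>M borel)"
    "\<And>n z. dist (Fs n z) (F z) \<le> 1 / real (Suc n)" by metis
  show ?thesis
  proof (rule borel_measurable_LIMSEQ_metric[OF Fs(1)])
    fix z
    show "(\<lambda>n. Fs n z) \<longlonglongrightarrow> F z"
      unfolding tendsto_dist_iff[of _ "F z"]
      by (rule tendsto_sandwich[OF _ _ tendsto_const LIMSEQ_Suc[OF lim_const_over_n[of 1]]])
         (use Fs(2) in \<open>auto intro!: always_eventually\<close>)
  qed
qed

locale compact_haar =
  fixes m :: "'a::{topological_ab_group_add, t2_space} measure"
  assumes compact_UNIV: "compact (UNIV :: 'a set)"
    and haar: "haar_probability m"
begin

sublocale prob_space m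
  using haar by (simp add: haar_probability_def)

lemma sets_m [measurable_cong]: "sets m = sets borel"
  using haar by (simp add: haar_probability_def)

lemma space_m [simp]: "space m = UNIV"
  using sets_eq_imp_space_eq[OF sets_m] by simp

lemma prob_UNIV [simp]: "prob UNIV = 1"
  using prob_space by simp

abbreviation cont :: "('a \<Rightarrow> complex) \<Rightarrow> bool" where
  "cont f \<equiv> continuous_on UNIV f"

lemma cont_compose: "cont f \<Longrightarrow> continuous_on A g \<Longrightarrow> continuous_on A (\<lambda>p. f (g p))"
  by (rule continuous_on_compose2[where t=UNIV]) auto

lemma cont_measurable: "cont f \<Longrightarrow> f \<in> borel_measurable m"
  by (simp add: borel_measurable_continuous_onI measurable_cong_sets[OF sets_m refl])

lemma cont_bounded:
  assumes "cont f"
  obtains B where "\<And>x. norm (f x) \<le> B"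
  using compact_imp_bounded[OF compact_continuous_image[OF assms compact_UNIV]]
  by (auto simp: bounded_iff)

lemma cont_in_L2: "cont f \<Longrightarrow> in_L2 m f"
  by (metis cont_bounded cont_measurable in_L2_bounded finite_measure_axioms)

lemma cont_integrable: "cont f \<Longrightarrow> integrable m f"
  by (rule in_L2_integrable[OF prob_space_axioms cont_in_L2])

lemma integral_translate:
  fixes f :: "'a \<Rightarrow> 'b::{banach, second_countable_topology}"
  assumes "f \<in> borel_measurable m"
  shows "(\<integral>x. f (x + a) \<partial>m) = (\<integral>x. f x \<partial>m)"
proof -
  have "continuous_on UNIV (\<lambda>x. a + x)" by (intro continuous_intros)
  then have "(\<lambda>x. a + x) \<in> measurable m m"
    by (simp add: borel_measurable_continuous_onI measurable_cong_sets[OF sets_m sets_m])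
  from integral_distr[OF this assms]
  have "(\<integral>x. f x \<partial>distr m m ((+) a)) = (\<integral>x. f (a + x) \<partial>m)" by simp
  with haar show ?thesis by (simp add: haar_probability_def add.commute)
qed

lemma Fubini_cont:
  fixes F :: "'a \<Rightarrow> 'a \<Rightarrow> complex"
  assumes "continuous_on UNIV (\<lambda>p. F (fst p) (snd p))"
  shows "(\<integral>x. (\<integral>y. F x y \<partial>m) \<partial>m) = (\<integral>y. (\<integral>x. F x y \<partial>m) \<partial>m)"
proof -
  interpret P: pair_prob_space m m ..
  have meas: "(\<lambda>p. F (fst p) (snd p)) \<in> borel_measurable (m \<Otimes>\<^sub>M m)"
    using borel_measurable_pair_continuous[OF assms compact_UNIV compact_UNIV]
    by (simp cong: measurable_cong_sets sets_pair_measure_cong add: sets_m)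
  have "compact (UNIV :: ('a \<times> 'a) set)"
    using compact_Times[OF compact_UNIV compact_UNIV] by simp
  from compact_imp_bounded[OF compact_continuous_image[OF assms this]]
  obtain B where "\<And>x y. norm (F x y) \<le> B" by (auto simp: bounded_iff)
  then have "integrable (m \<Otimes>\<^sub>M m) (\<lambda>p. F (fst p) (snd p))"
    by (intro P.integrable_const_bound[where B=B] meas) auto
  then have "integrable (m \<Otimes>\<^sub>M m) (\<lambda>(x, y). F x y)" by (simp add: case_prod_beta')
  from P.Fubini_integral[OF this] show ?thesis by simp
qed

text \<open>Over a compact factor the sections near \<open>x\<close> are uniformly close to the one
  at \<open>x\<close>. Dominated convergence would give sequential continuity only.\<close>

lemma cont_parametric_integral:
  fixes F :: "'a \<Rightarrow> 'a \<Rightarrow> complex"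
  assumes "continuous_on UNIV (\<lambda>p. F (fst p) (snd p))"
  shows "cont (\<lambda>x. \<integral>y. F x y \<partial>m)"
  unfolding continuous_on_def tendsto_iff
proof (intro ballI allI impI)
  fix x :: 'a and e :: real
  assume "0 < e"
  then have "0 < e / 2" by simp
  have Fx: "cont (F x)" for x
  proof -
    have "continuous_on UNIV (Pair x :: 'a \<Rightarrow> _)" by (intro continuous_intros)
    from continuous_on_compose2[OF assms this] show ?thesis by simp
  qed
  obtain U where U: "x \<in> U" "open U" "\<forall>z\<in>U \<inter> UNIV. \<forall>y\<in>UNIV. dist (F z y) (F x y) \<le> e / 2"
    using continuous_on_prod_compactE[of UNIV UNIV "\<lambda>p. F (fst p) (snd p)" x "e / 2"]
      assms compact_UNIV \<open>0 < e / 2\<close> by (metis UNIV_I UNIV_Times_UNIV fst_conv snd_conv)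
  have "dist (\<integral>y. F z y \<partial>m) (\<integral>y. F x y \<partial>m) < e" if "z \<in> U" for z
  proof -
    have "dist (\<integral>y. F z y \<partial>m) (\<integral>y. F x y \<partial>m) = norm (\<integral>y. F z y - F x y \<partial>m)"
      by (simp add: dist_norm cont_integrable[OF Fx])
    also have "\<dots> \<le> (\<integral>y. norm (F z y - F x y) \<partial>m)"
      by (rule integral_norm_bound)
    also have "\<dots> \<le> (\<integral>y. e / 2 \<partial>m)"
      using U(3) that by (intro integral_mono) (auto intro!: cont_integrable integrable_norm continuous_on_diff Fx simp: dist_norm)
    also have "\<dots> < e" using \<open>0 < e\<close> by (simp add: prob_space)
    finally show ?thesis .
  qed
  then show "\<forall>\<^sub>F z in at x within UNIV. dist (\<integral>y. F z y \<partial>m) (\<integral>y. F x y \<partial>m) < e"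
    using U(1,2) by (auto simp: eventually_at_topological)
qed

text \<open>Haar measure has full support: finitely many translates of the open set where
  \<open>g\<close> is large cover the group, and all translates of \<open>g\<close> have the same
  norm.\<close>

lemma sq_norm_pos:
  assumes "cont g" "g x0 \<noteq> 0"
  shows "0 < sq_norm m g"
proof -
  note [continuous_intros] = cont_compose[OF assms(1)]
  define c where "c = norm (g x0) / 2"
  have c: "0 < c" "c < norm (g x0)" using assms(2) by (auto simp: c_def)
  define U where "U a = {y. c < norm (g (y + a))}" for a
  have "open (U a)" for a
    unfolding U_def by (intro open_Collect_less continuous_intros)
  moreover have "UNIV \<subseteq> (\<Union>a\<in>UNIV. U a)"
  proof
    fix y
    have "y \<in> U (x0 - y)" using c by (simp add: U_def)
    then show "y \<in> (\<Union>a\<in>UNIV. U a)" by blast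
  qed
  ultimately obtain T where T: "finite T" "UNIV \<subseteq> (\<Union>a\<in>T. U a)"
    using compactE_image[OF compact_UNIV, of UNIV U] by metis
  have int: "integrable m (\<lambda>y. (norm (g (y + a)))\<^sup>2)" for a
  proof -
    have "cont (\<lambda>y. g (y + a))" by (intro continuous_intros)
    from cont_in_L2[OF this] show ?thesis by (simp add: in_L2_def)
  qed
  have "c\<^sup>2 = (\<integral>y. c\<^sup>2 \<partial>m)" by (simp add: prob_space)
  also have "\<dots> \<le> (\<integral>y. (\<Sum>a\<in>T. (norm (g (y + a)))\<^sup>2) \<partial>m)"
  proof (rule integral_mono)
    show "c\<^sup>2 \<le> (\<Sum>a\<in>T. (norm (g (y + a)))\<^sup>2)" for y
    proof -
      obtain a where a: "a \<in> T" "y \<in> U a" using T(2) by blast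
      then have "c\<^sup>2 \<le> (norm (g (y + a)))\<^sup>2"
        using c by (intro power_mono) (auto simp: U_def)
      also have "\<dots> \<le> (\<Sum>a\<in>T. (norm (g (y + a)))\<^sup>2)"
        using T(1) a(1) by (intro member_le_sum) auto
      finally show ?thesis .
    qed
  qed (use int in auto)
  also have "\<dots> = (\<Sum>a\<in>T. \<integral>y. (norm (g (y + a)))\<^sup>2 \<partial>m)"
    using int by (intro Bochner_Integration.integral_sum) auto
  also have "\<dots> = (\<Sum>a\<in>T. sq_norm m g)"
  proof (rule sum.cong[OF refl])
    fix a
    have "(\<lambda>y. (norm (g y))\<^sup>2) \<in> borel_measurable m"
      using cont_in_L2[OF assms(1)] by (simp add: in_L2_def borel_measurable_integrable)
    from integral_translate[OF this] show "(\<integral>y. (norm (g (y + a)))\<^sup>2 \<partial>m) = sq_norm m g"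
      by (simp add: sq_norm_def)
  qed
  also have "\<dots> = real (card T) * sq_norm m g" by simp
  finally have "0 < real (card T) * sq_norm m g" using c(1) by (smt (verit) zero_less_power)
  then show ?thesis by (simp add: zero_less_mult_iff)
qed

section \<open>Convolution and its involution\<close>

definition conv :: "('a \<Rightarrow> complex) \<Rightarrow> ('a \<Rightarrow> complex) \<Rightarrow> 'a \<Rightarrow> complex" where
  "conv f k x = (\<integral>y. f (x - y) * k y \<partial>m)"

text \<open>Convolution with \<open>star f\<close> is the L^2 adjoint of convolution with
  \<open>f\<close>, so \<open>star f = f\<close> says that the convolution operator is
  self-adjoint.\<close>

definition star :: "('a \<Rightarrow> complex) \<Rightarrow> 'a \<Rightarrow> complex" where
  "star f x = cnj (f (- x))"

lemma star_star [simp]: "star (star f) = f"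
  by (simp add: star_def fun_eq_iff)

lemma cont_star: "cont f \<Longrightarrow> cont (star f)"
  unfolding star_def by (rule continuous_on_cnj, erule cont_compose) (intro continuous_intros)

lemma cont_conv_integrand:
  assumes "cont f" "cont k"
  shows "cont (\<lambda>y. f (x - y) * k y)"
  by (intro continuous_intros cont_compose[OF assms(1)] cont_compose[OF assms(2)])

lemma conv_integrable: "cont f \<Longrightarrow> cont k \<Longrightarrow> integrable m (\<lambda>y. f (x - y) * k y)"
  by (rule cont_integrable[OF cont_conv_integrand])

lemma cont_conv:
  assumes "cont f" "cont k"
  shows "cont (conv f k)"
  unfolding conv_def[abs_def]
  by (rule cont_parametric_integral) (intro continuous_intros cont_compose[OF assms(1)] cont_compose[OF assms(2)])

lemma conv_assoc:
  assumes f: "cont f" and k: "cont k" and l: "cont l"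
  shows "conv (conv f k) l = conv f (conv k l)"
proof
  fix x
  note [continuous_intros] = cont_compose[OF f] cont_compose[OF k] cont_compose[OF l]
  have "conv f (conv k l) x = (\<integral>y. (\<integral>z. f (x - y) * (k (y - z) * l z) \<partial>m) \<partial>m)"
    by (simp add: conv_def conv_integrable[OF k l])
  also have "\<dots> = (\<integral>z. (\<integral>y. f (x - y) * (k (y - z) * l z) \<partial>m) \<partial>m)"
    by (rule Fubini_cont) (intro continuous_intros)
  also have "\<dots> = (\<integral>z. conv f k (x - z) * l z \<partial>m)"
  proof (rule Bochner_Integration.integral_cong[OF refl])
    fix z
    have "(\<integral>y. f (x - y) * (k (y - z) * l z) \<partial>m) = (\<integral>y. f (x - (y + z)) * (k (y + z - z) * l z) \<partial>m)"
      by (rule integral_translate[symmetric], rule cont_measurable) (intro continuous_intros)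
    also have "\<dots> = (\<integral>y. (f (x - z - y) * k y) * l z \<partial>m)"
      by (simp only: diff_diff_eq add.commute[of z] add_diff_cancel_right' mult.assoc)
    also have "\<dots> = conv f k (x - z) * l z"
      by (simp add: conv_def conv_integrable[OF f k])
    finally show "(\<integral>y. f (x - y) * (k (y - z) * l z) \<partial>m) = conv f k (x - z) * l z" .
  qed
  finally show "conv (conv f k) l x = conv f (conv k l) x"
    by (simp add: conv_def[of "conv f k"])
qed

lemma star_conv:
  assumes f: "cont f" and k: "cont k"
  shows "star (conv f k) = conv (star k) (star f)"
proof
  fix x
  note [continuous_intros] = cont_compose[OF f] cont_compose[OF k]
  have "conv (star k) (star f) x = (\<integral>y. cnj (k (y - x)) * cnj (f (- y)) \<partial>m)"
    by (simp add: conv_def star_def)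
  also have "\<dots> = (\<integral>y. cnj (k (y + x - x)) * cnj (f (- (y + x))) \<partial>m)"
    by (rule integral_translate[symmetric], rule cont_measurable) (intro continuous_intros)
  also have "\<dots> = (\<integral>y. cnj (f (- x - y) * k y) \<partial>m)"
  proof -
    have "- (y + x) = - x - y" for y by simp
    then show ?thesis by (simp only: add_diff_cancel_right' complex_cnj_mult mult.commute)
  qed
  also have "\<dots> = star (conv f k) x"
    by (simp add: star_def conv_def del: complex_cnj_mult)
  finally show "star (conv f k) x = conv (star k) (star f) x" by simp
qed

text \<open>Commutativity of the group enters here: together with
  \<open>conv_translate_right\<close>, the same translation passes through either factor. Hence an
  idempotent absorbs its own translates on both sides.\<close>

lemma conv_translate_left: "conv (\<lambda>x. f (x + a)) k = (\<lambda>x. conv f k (x + a))"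
  by (simp only: conv_def fun_eq_iff diff_add_eq simp_thms)

lemma conv_translate_right:
  assumes f: "cont f" and k: "cont k"
  shows "conv f (\<lambda>x. k (x + a)) = (\<lambda>x. conv f k (x + a))"
proof
  fix x
  have "(\<integral>y. f (x + a - (y + a)) * k (y + a) \<partial>m) = (\<integral>y. f (x + a - y) * k y \<partial>m)"
    by (rule integral_translate[OF cont_measurable[OF cont_conv_integrand[OF f k]]])
  then show "conv f (\<lambda>x. k (x + a)) x = conv f k (x + a)" by (simp add: conv_def)
qed

lemma conv_add_left:
  "cont f \<Longrightarrow> cont g \<Longrightarrow> cont k \<Longrightarrow> conv (\<lambda>x. f x + g x) k = (\<lambda>x. conv f k x + conv g k x)"
  by (simp add: conv_def fun_eq_iff distrib_right conv_integrable)

lemma conv_add_right: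
  "cont f \<Longrightarrow> cont g \<Longrightarrow> cont k \<Longrightarrow> conv k (\<lambda>x. f x + g x) = (\<lambda>x. conv k f x + conv k g x)"
  by (simp add: conv_def fun_eq_iff distrib_left conv_integrable)

lemma conv_diff_left:
  "cont f \<Longrightarrow> cont g \<Longrightarrow> cont k \<Longrightarrow> conv (\<lambda>x. f x - g x) k = (\<lambda>x. conv f k x - conv g k x)"
  by (simp add: conv_def fun_eq_iff left_diff_distrib conv_integrable)

lemma conv_diff_right:
  "cont f \<Longrightarrow> cont g \<Longrightarrow> cont k \<Longrightarrow> conv k (\<lambda>x. f x - g x) = (\<lambda>x. conv k f x - conv k g x)"
  by (simp add: conv_def fun_eq_iff right_diff_distrib conv_integrable)

lemma conv_cmult_left: "conv (\<lambda>x. c * f x) k = (\<lambda>x. c * conv f k x)"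
  by (simp add: conv_def fun_eq_iff mult.assoc)

lemma conv_cmult_right: "conv k (\<lambda>x. c * f x) = (\<lambda>x. c * conv k f x)"
  by (simp add: conv_def fun_eq_iff mult.left_commute)

lemma conv_zero_left: "conv (\<lambda>_. 0) k = (\<lambda>_. 0)"
  by (simp add: conv_def fun_eq_iff)

text \<open>Makes squared norms computable: for self-adjoint convolution powers they become values
  at 0 of higher powers.\<close>

lemma conv_star_self_0: "conv (star f) f 0 = of_real (sq_norm m f)"
proof -
  have "conv (star f) f 0 = (\<integral>y. of_real ((norm (f y))\<^sup>2) \<partial>m)"
    unfolding conv_def star_def
    by (intro Bochner_Integration.integral_cong refl) (simp only: minus_diff_eq diff_zero mult.commute complex_norm_square diff_0 minus_minus)
  then show ?thesis by (simp only: integral_complex_of_real sq_norm_def)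
qed

text \<open>Cauchy--Schwarz leaves a reflected copy of \<open>h\<close>. Self-adjointness gives
  \<open>norm (h (x - y)) = norm (h (y - x))\<close>, and the right side is a translate in
  \<open>y\<close>, so translation invariance suffices.\<close>

lemma norm_conv_le:
  assumes h: "cont h" "star h = h" and k: "cont k"
  shows "norm (conv h k x) \<le> sqrt (sq_norm m h) * sqrt (sq_norm m k)"
proof -
  note [continuous_intros] = cont_compose[OF h(1)] cont_compose[OF k]
  have c: "cont (\<lambda>y. h (x - y))" by (intro continuous_intros)
  have "norm (h (x - y)) = norm (h (y - x))" for y
    using fun_cong[OF h(2), of "x - y"] by (metis star_def complex_mod_cnj minus_diff_eq)
  then have "sq_norm m (\<lambda>y. h (x - y)) = (\<integral>y. (norm (h (y + - x)))\<^sup>2 \<partial>m)"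
    by (simp add: sq_norm_def)
  also have "\<dots> = sq_norm m h"
    unfolding sq_norm_def
    by (rule integral_translate[of "\<lambda>y. (norm (h y))\<^sup>2"])
       (use cont_in_L2[OF h(1)] in \<open>simp add: in_L2_def borel_measurable_integrable\<close>)
  finally show ?thesis
    using L2_Cauchy_Schwarz[OF cont_in_L2[OF c] cont_in_L2[OF k]] by (simp add: conv_def)
qed

lemma conv_LIMSEQ:
  assumes k: "cont k" and s: "\<And>n. cont (s n)" and q: "cont q"
    and lim: "\<And>x. (\<lambda>n. s n x) \<longlonglongrightarrow> q x" and bd: "\<And>n x. norm (s n x) \<le> B"
  shows "(\<lambda>n. conv k (s n) x) \<longlonglongrightarrow> conv k q x"
proof -
  obtain C where C: "\<And>x. norm (k x) \<le> C" using cont_bounded[OF k] by blast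
  show ?thesis
    unfolding conv_def
  proof (rule integral_dominated_convergence[where w="\<lambda>_. C * B"])
    show "(\<lambda>y. k (x - y) * q y) \<in> borel_measurable m" "(\<lambda>y. k (x - y) * s n y) \<in> borel_measurable m" for n
      by (intro cont_measurable cont_conv_integrand k q s)+
    show "AE y in m. (\<lambda>n. k (x - y) * s n y) \<longlonglongrightarrow> k (x - y) * q y"
      by (intro AE_I2 tendsto_mult tendsto_const lim)
    have "0 \<le> C" using C[of 0] norm_ge_zero order_trans by blast
    then show "AE y in m. norm (k (x - y) * s n y) \<le> C * B" for n
      using C bd by (intro AE_I2) (simp add: norm_mult mult_mono)
  qed simp
qed

end

section \<open>Continuous characters separate points\<close>

context compact_haar
begin

text \<open>In spectral terms \<open>A n\<close> is the sum of the \<open>(2n+2)\<close>-th powers of the eigenvalues of convolution with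
  \<open>h\<close>, \<open>L\<close> is the largest squared eigenvalue and \<open>q\<close> projects onto its eigenspace. Convergence follows
  from \<open>A\<close> being log-convex (Cauchy--Schwarz), and \<open>q \<noteq> 0\<close> from \<open>A\<close> being submultiplicative, which
  forces \<open>A n \<ge> L\<^bsup>n+1\<^esup>\<close>.\<close>

lemma power_iteration:
  assumes h: "cont h" "star h = h" "h x0 \<noteq> 0"
  obtains q and L :: real where "cont q" "star q = q" "conv q q = q" "q 0 \<noteq> 0" "0 < L"
    "conv (conv h h) q = (\<lambda>x. of_real L * q x)"
    "\<forall>p. cont p \<and> conv p h = h \<longrightarrow> conv p q = q"
proof -
  \<comment> \<open>\<open>P n\<close> is the convolution power of exponent \<open>n + 1\<close>:
    the numbering starts at \<open>h\<close>, hence the summand 1 in \<open>P_add\<close>.\<close>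
  define P where "P n = (conv h ^^ n) h" for n
  have P0: "P 0 = h" and PSuc: "P (Suc n) = conv h (P n)" for n
    by (simp_all add: P_def)
  have contP: "cont (P n)" for n
    by (induction n) (simp_all add: P0 PSuc cont_conv h(1))
  have P_add: "conv (P n) (P k) = P (n + k + 1)" for n k
    by (induction n) (simp_all add: P0 PSuc conv_assoc[OF h(1) contP contP])
  have starP: "star (P n) = P n" for n
  proof (induction n)
    case (Suc n)
    have "star (P (Suc n)) = conv (P n) (P 0)"
      by (simp add: PSuc star_conv[OF h(1) contP] Suc h(2) P0)
    then show ?case by (simp add: P_add)
  qed (simp add: P0 h(2))
  define A where "A n = sq_norm m (P n)" for n
  have A_nonneg: "0 \<le> A n" for n by (simp add: A_def sq_norm_nonneg)
  \<comment> \<open>The exponent \<open>2n + 2\<close> splits as \<open>P n\<close> convolved with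
    its own adjoint, so the value at 0 is a squared norm.\<close>
  have P_at_0: "P (2 * n + 1) 0 = of_real (A n)" for n
    using conv_star_self_0[of "P n"] by (simp add: starP P_add A_def mult_2)
  have P_le: "norm (P (2 * n + 1) x) \<le> A n" for n x
    using norm_conv_le[OF contP starP contP, of n n x] A_nonneg[of n]
    by (simp add: P_add A_def mult_2)
  have log_convex: "(A (Suc n))\<^sup>2 \<le> A n * A (Suc (Suc n))" for n
  proof -
    \<comment> \<open>Cauchy--Schwarz is applied to the unequal splitting
      \<open>(n + 1) + (n + 3)\<close> of the exponent \<open>2n + 4\<close>.\<close>
    have "conv (P n) (P (n + 2)) = P (2 * (Suc n) + 1)" by (simp add: P_add mult_2)
    then have "conv (P n) (P (n + 2)) 0 = of_real (A (Suc n))"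
      using P_at_0[of "Suc n"] by simp
    then have "A (Suc n) \<le> sqrt (A n) * sqrt (A (Suc (Suc n)))"
      using norm_conv_le[OF contP starP contP, of n "n + 2" 0] A_nonneg[of "Suc n"]
      by (simp add: A_def)
    then have "(A (Suc n))\<^sup>2 \<le> (sqrt (A n) * sqrt (A (Suc (Suc n))))\<^sup>2"
      by (intro power_mono A_nonneg)
    then show ?thesis by (simp add: power_mult_distrib A_nonneg)
  qed
  have A_pos: "0 < A n" for n
  proof -
    have "0 < A 0" using sq_norm_pos[OF h(1,3)] by (simp add: A_def P0)
    \<comment> \<open>\<open>P 1\<close> has the value \<open>A 0\<close> at 0 and so does not
      vanish; from two consecutive positive terms, log-convexity propagates positivity.\<close>
    moreover from this have "0 < A 1"
      using P_at_0[of 0] sq_norm_pos[OF contP, of 1 0] by (simp add: A_def)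
    ultimately have "0 < A n \<and> 0 < A (Suc n)"
    proof (induction n)
      case (Suc n)
      then have "0 < A n * A (Suc (Suc n))" using log_convex[of n] by (smt (verit) zero_less_power)
      with Suc show ?case by (simp add: zero_less_mult_iff)
    qed simp
    then show ?thesis by simp
  qed
  have submult: "A (n + k + 1) \<le> A n * A k" for n k
  proof -
    have "conv (P (2 * n + 1)) (P (2 * k + 1)) = P (2 * (n + k + 1) + 1)"
      by (simp add: P_add algebra_simps)
    then have "A (n + k + 1) = norm (conv (P (2 * n + 1)) (P (2 * k + 1)) 0)"
      using P_at_0[of "n + k + 1"] A_nonneg[of "n + k + 1"] by simp
    also have "\<dots> \<le> (\<integral>y. norm (P (2 * n + 1) (0 - y) * P (2 * k + 1) y) \<partial>m)"
      unfolding conv_def by (rule integral_norm_bound)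
    also have "\<dots> \<le> (\<integral>y. A n * A k \<partial>m)"
    proof (rule integral_mono)
      show "integrable m (\<lambda>y. norm (P (2 * n + 1) (0 - y) * P (2 * k + 1) y))"
        by (intro integrable_norm conv_integrable contP)
      show "norm (P (2 * n + 1) (0 - y) * P (2 * k + 1) y) \<le> A n * A k" for y
        unfolding norm_mult by (intro mult_mono P_le A_nonneg norm_ge_zero)
    qed simp
    finally show ?thesis by simp
  qed
  define r where "r n = A (Suc n) / A n" for n
  have "incseq r"
    using log_convex A_pos
    by (intro incseq_SucI) (simp add: r_def divide_simps power2_eq_square mult.commute)
  moreover have "r n \<le> A 0" for n
    using submult[of n 0] A_pos[of n] by (simp add: r_def divide_simps mult.commute)
  ultimately obtain L where L: "r \<longlonglongrightarrow> L" "\<And>n. r n \<le> L"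
    using incseq_convergent[of r "A 0"] by blast
  have "0 < r 0" using A_pos by (simp add: r_def)
  with L(2)[of 0] have L_pos: "0 < L" by simp
  have ratio: "(\<lambda>n. A (n + k + 1) / A n) \<longlonglongrightarrow> L ^ (k + 1)" for k
  proof (induction k)
    case 0
    then show ?case using L(1) by (simp add: r_def[abs_def])
  next
    case (Suc k)
    have "(\<lambda>n. r (n + (k + 1)) * (A (n + k + 1) / A n)) \<longlonglongrightarrow> L * L ^ (k + 1)"
      by (intro tendsto_mult Suc LIMSEQ_ignore_initial_segment[OF L(1)])
    moreover have "(\<lambda>n. r (n + (k + 1)) * (A (n + k + 1) / A n)) = (\<lambda>n. A (n + Suc k + 1) / A n)"
      using A_pos[THEN less_imp_neq, THEN not_sym] by (simp add: r_def)
    ultimately show ?case by (simp only: add_Suc power_Suc)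
  qed
  \<comment> \<open>Divide \<open>submult\<close> by \<open>A n\<close> and let \<open>n\<close>
    tend to infinity.\<close>
  have L_le: "L ^ (k + 1) \<le> A k" for k
    by (rule LIMSEQ_le_const2[OF ratio])
       (use submult[of _ k] A_pos in \<open>auto intro!: exI[of _ 0] simp: divide_simps mult.commute\<close>)
  \<comment> \<open>In spectral terms the limit of \<open>b\<close> is the dimension of the
    eigenspace for the squared eigenvalue \<open>L\<close>; \<open>L_le\<close> keeps it at least
    1.\<close>
  define b where "b n = A n / L ^ (n + 1)" for n
  have "decseq b"
  proof (rule decseq_SucI)
    fix n
    have "A (Suc n) \<le> L * A n" using L(2)[of n] A_pos[of n] by (simp add: r_def divide_simps mult.commute)
    then show "b (Suc n) \<le> b n"
      using L_pos by (simp add: b_def divide_simps mult.commute)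
  qed
  moreover have b_ge: "1 \<le> b n" for n
    using L_le[of n] L_pos by (simp add: b_def)
  ultimately obtain bl where bl: "b \<longlonglongrightarrow> bl"
    using decseq_convergent[of b 1] by blast
  have b_le: "b n \<le> b 0" for n using \<open>decseq b\<close> by (simp add: decseq_def)
  \<comment> \<open>Even exponents only: with a negative eigenvalue of largest modulus, odd and even
    powers would have different limits.\<close>
  define \<psi> where "\<psi> n = (\<lambda>x. of_real (1 / L ^ (n + 1)) * P (2 * n + 1) x)" for n
  have cont\<psi>: "cont (\<psi> n)" for n
    unfolding \<psi>_def by (intro continuous_intros contP)
  have star\<psi>: "star (\<psi> n) = \<psi> n" for n
    using fun_cong[OF starP[of "2 * n + 1"]] by (simp add: star_def \<psi>_def fun_eq_iff)
  have \<psi>_add: "conv (\<psi> n) (\<psi> k) = \<psi> (n + k + 1)" for n k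
    unfolding \<psi>_def conv_cmult_left conv_cmult_right P_add
    by (simp add: fun_eq_iff algebra_simps power_add)
  have \<psi>_0: "\<psi> n 0 = of_real (b n)" for n
    unfolding \<psi>_def P_at_0 by (simp add: b_def)
  have \<psi>_le: "norm (\<psi> n x) \<le> b 0" for n x
  proof -
    have "norm (\<psi> n x) \<le> b n"
      using P_le[of n x] L_pos by (simp add: \<psi>_def b_def norm_mult norm_divide norm_power divide_right_mono)
    with b_le[of n] show ?thesis by simp
  qed
  \<comment> \<open>Each term of the expansion is some \<psi> at 0, so convergence of the single
    real sequence \<open>b\<close> makes \<psi> Cauchy in L^2.\<close>
  have sq\<psi>: "sq_norm m (\<lambda>x. \<psi> n x - \<psi> k x) = b (2 * n + 1) + b (2 * k + 1) - 2 * b (n + k + 1)" for n k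
  proof -
    let ?d = "\<lambda>x. \<psi> n x - \<psi> k x"
    have d: "cont ?d" by (intro continuous_intros cont\<psi>)
    have "star ?d = ?d"
      using fun_cong[OF star\<psi>[of n]] fun_cong[OF star\<psi>[of k]] by (simp add: star_def fun_eq_iff)
    then have "of_real (sq_norm m ?d) = conv ?d ?d 0"
      using conv_star_self_0[of ?d] by simp
    also have "\<dots> = \<psi> (2 * n + 1) 0 + \<psi> (2 * k + 1) 0 - 2 * \<psi> (n + k + 1) 0"
      unfolding conv_diff_left[OF cont\<psi> cont\<psi> d] conv_diff_right[OF cont\<psi> cont\<psi> cont\<psi>] \<psi>_add
      by (simp only: mult_2 add.commute[of k n]) simp
    also have "\<dots> = of_real (b (2 * n + 1) + b (2 * k + 1) - 2 * b (n + k + 1))"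
      by (simp add: \<psi>_0)
    finally show ?thesis by (simp only: of_real_eq_iff)
  qed
  define C where "C = sqrt (sq_norm m (\<psi> 0))"
  have C_nonneg: "0 \<le> C" by (simp add: C_def sq_norm_nonneg)
  \<comment> \<open>Convolution with \<open>\<psi> 0\<close> is bounded from L^2 to the sup norm.
    Splitting off this factor upgrades the Cauchy property from L^2 to uniform and causes the index
    shift.\<close>
  have "uniformly_Cauchy_on UNIV (\<lambda>n. \<psi> (Suc n))"
    unfolding uniformly_Cauchy_on_def
  proof (intro allI impI)
    fix e :: real
    assume "0 < e"
    \<comment> \<open>The three deviations of \<open>b\<close> occur with weights 1, 1 and 2, hence
      the 4; \<open>C + 1\<close> avoids a zero divisor and makes the final inequality
      strict.\<close>
    define d where "d = (e / (C + 1))\<^sup>2 / 4"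
    have "0 < d" using \<open>0 < e\<close> C_nonneg by (simp add: d_def)
    with bl obtain N where N: "\<And>n. N \<le> n \<Longrightarrow> \<bar>b n - bl\<bar> < d"
      by (auto simp: LIMSEQ_iff real_norm_def)
    have "dist (\<psi> (Suc n) x) (\<psi> (Suc k) x) < e" if "N \<le> n" "N \<le> k" for n k x
    proof -
      let ?d = "\<lambda>x. \<psi> n x - \<psi> k x"
      have "\<psi> (Suc n) x - \<psi> (Suc k) x = conv (\<psi> 0) ?d x"
        by (simp add: conv_diff_right[OF cont\<psi> cont\<psi> cont\<psi>] \<psi>_add)
      then have "dist (\<psi> (Suc n) x) (\<psi> (Suc k) x) \<le> C * sqrt (sq_norm m ?d)"
        unfolding dist_norm C_def
        by (simp only:) (intro norm_conv_le cont\<psi> star\<psi> continuous_on_diff)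
      also have "\<dots> \<le> C * (e / (C + 1))"
      proof (intro mult_left_mono C_nonneg real_le_lsqrt)
        have "\<bar>b (2 * n + 1) - bl\<bar> < d" "\<bar>b (2 * k + 1) - bl\<bar> < d" "\<bar>b (n + k + 1) - bl\<bar> < d"
          using that by (auto intro!: N)
        then have "b (2 * n + 1) + b (2 * k + 1) - 2 * b (n + k + 1) \<le> 4 * d" by linarith
        then show "sq_norm m ?d \<le> (e / (C + 1))\<^sup>2"
          unfolding sq\<psi> by (simp add: d_def)
      qed (use \<open>0 < e\<close> C_nonneg sq_norm_nonneg in auto)
      also have "\<dots> < e" using \<open>0 < e\<close> C_nonneg by (simp add: divide_simps)
      finally show ?thesis .
    qed
    then show "\<exists>M. \<forall>x\<in>UNIV. \<forall>n\<ge>M. \<forall>k\<ge>M. dist (\<psi> (Suc n) x) (\<psi> (Suc k) x) < e" by blast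
  qed
  then obtain q where q: "uniform_limit UNIV (\<lambda>n. \<psi> (Suc n)) q sequentially"
    using Cauchy_uniformly_convergent uniformly_convergent_on_def by blast
  have contq: "cont q"
    by (rule uniform_limit_theorem[OF _ q]) (auto intro: always_eventually cont\<psi>)
  have lim: "(\<lambda>n. \<psi> n x) \<longlonglongrightarrow> q x" for x
    by (rule LIMSEQ_imp_Suc, rule tendsto_uniform_limitI[OF q]) simp
  have starq: "star q = q"
  proof
    fix x
    have "(\<lambda>n. star (\<psi> n) x) \<longlonglongrightarrow> star q x"
      unfolding star_def by (intro tendsto_cnj lim)
    then show "star q x = q x"
      unfolding star\<psi> using lim LIMSEQ_unique by blast
  qed
  have conv_lim: "(\<lambda>n. conv k (\<psi> n) x) \<longlonglongrightarrow> conv k q x" if "cont k" for k x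
    by (rule conv_LIMSEQ[OF that cont\<psi> contq lim \<psi>_le])
  have \<psi>q: "conv (\<psi> n) q = q" for n
  proof
    fix x
    have "(\<lambda>k. \<psi> (k + (n + 1)) x) \<longlonglongrightarrow> conv (\<psi> n) q x"
      using conv_lim[OF cont\<psi>, of n x] by (simp add: \<psi>_add add.commute)
    with LIMSEQ_ignore_initial_segment[OF lim] show "conv (\<psi> n) q x = q x"
      using LIMSEQ_unique by blast
  qed
  have q\<psi>: "conv q (\<psi> n) = q" for n
    using star_conv[OF cont\<psi> contq, of n] by (simp add: \<psi>q star\<psi> starq)
  have idem: "conv q q = q"
    using conv_lim[OF contq] by (simp add: q\<psi> fun_eq_iff LIMSEQ_const_iff)
  have "(\<lambda>n. of_real (b n)) \<longlonglongrightarrow> (of_real bl :: complex)"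
    by (intro tendsto_of_real bl)
  then have "q 0 = of_real bl" using lim[of 0] LIMSEQ_unique by (auto simp: \<psi>_0)
  moreover have "1 \<le> bl" by (rule LIMSEQ_le_const[OF bl]) (use b_ge in auto)
  ultimately have q0: "q 0 \<noteq> 0" by auto
  have "conv h h = (\<lambda>x. of_real L * \<psi> 0 x)"
    using L_pos PSuc[of 0] by (simp add: \<psi>_def P0)
  then have eig: "conv (conv h h) q = (\<lambda>x. of_real L * q x)"
    by (simp add: conv_cmult_left \<psi>q)
  \<comment> \<open>Whatever absorbs \<open>h\<close> absorbs its powers and their limit. This
    places \<open>q\<close> below a given idempotent, ready for minimality.\<close>
  have "conv p q = q" if p: "cont p" "conv p h = h" for p
  proof -
    have "conv p (P n) = P n" for n
      by (cases n) (simp_all add: P0 PSuc p(2) flip: conv_assoc[OF p(1) h(1) contP])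
    then have "conv p (\<psi> n) = \<psi> n" for n
      unfolding \<psi>_def conv_cmult_right by simp
    then show ?thesis
      using conv_lim[OF p(1)] lim LIMSEQ_unique by (fastforce simp: fun_eq_iff)
  qed
  with that[OF contq starq idem q0 L_pos eig] show thesis by blast
qed

end

section \<open>Characters from minimal idempotents\<close>

lemma dual_groupD:
  assumes "\<gamma> \<in> dual_group"
  shows "continuous_on UNIV \<gamma>" "norm (\<gamma> x) = 1" "\<gamma> (x + y) = \<gamma> x * \<gamma> y"
    "\<gamma> 0 = 1" "\<gamma> (- x) = cnj (\<gamma> x)" "\<gamma> (x - y) = \<gamma> x * cnj (\<gamma> y)"
proof -
  show "continuous_on UNIV \<gamma>" using assms by (simp add: dual_group_def)
  have n: "norm (\<gamma> x) = 1" for x using assms by (simp add: dual_group_def)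
  have a: "\<gamma> (x + y) = \<gamma> x * \<gamma> y" for x y using assms by (simp add: dual_group_def)
  show "norm (\<gamma> x) = 1" "\<gamma> (x + y) = \<gamma> x * \<gamma> y" by (fact n a)+
  have "\<gamma> 0 * \<gamma> 0 = \<gamma> 0" using a[of 0 0] by simp
  moreover have "\<gamma> 0 \<noteq> 0" using n[of 0] by auto
  ultimately show 0: "\<gamma> 0 = 1" by simp
  have minus: "\<gamma> (- x) = cnj (\<gamma> x)" for x
  proof -
    have "\<gamma> (- x) * \<gamma> x = 1" using a[of "- x" x] 0 by simp
    moreover have "cnj (\<gamma> x) * \<gamma> x = 1"
      using complex_norm_square[of "\<gamma> x"] n[of x] by (simp add: mult.commute)
    moreover have "\<gamma> x \<noteq> 0" using n[of x] by auto
    ultimately show ?thesis by (metis mult_cancel_right)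
  qed
  then show "\<gamma> (- x) = cnj (\<gamma> x)" .
  show "\<gamma> (x - y) = \<gamma> x * cnj (\<gamma> y)"
    using a[of x "- y"] minus[of y] by simp
qed

lemma dual_group_one: "(\<lambda>_. 1) \<in> dual_group"
  by (simp add: dual_group_def)

lemma dual_group_mult: "\<gamma> \<in> dual_group \<Longrightarrow> \<delta> \<in> dual_group \<Longrightarrow> (\<lambda>x. \<gamma> x * \<delta> x) \<in> dual_group"
  by (auto simp: dual_group_def norm_mult intro: continuous_on_mult)

lemma dual_group_cnj: "\<gamma> \<in> dual_group \<Longrightarrow> (\<lambda>x. cnj (\<gamma> x)) \<in> dual_group"
  by (auto simp: dual_group_def intro: continuous_on_cnj)

lemma dual_group_comp_Epi:
  assumes "\<gamma> \<in> dual_group" "\<tau> \<in> Epi"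
  shows "\<gamma> \<circ> \<tau> \<in> dual_group"
  using assms by (auto simp: dual_group_def Epi_def Modules.additive_def intro: continuous_on_compose2[of UNIV \<gamma>])

context compact_haar
begin

lemma idempotent_at_0:
  assumes p: "cont p" "star p = p" "conv p p = p"
  shows "p 0 = of_real (sq_norm m p)"
  using conv_star_self_0[of p] p by simp

text \<open>Writing \<open>p\<close> as its own convolution square bounds the sup norm by
  \<open>s = sq_norm m p\<close>. On a probability space \<open>s\<close> is at most the square of
  that bound, so \<open>s \<le> s^2\<close>. This gap above 0 makes the descent terminate.\<close>

lemma idempotent_ge_1:
  assumes p: "cont p" "star p = p" "conv p p = p" "p x0 \<noteq> 0"
  shows "1 \<le> sq_norm m p"
proof -
  let ?s = "sq_norm m p"
  have pos: "0 < ?s" by (rule sq_norm_pos[OF p(1,4)])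
  have "norm (p x) \<le> ?s" for x
    using norm_conv_le[OF p(1,2,1), of x] pos by (simp add: p(3))
  then have "?s \<le> ?s\<^sup>2"
    using sq_norm_le_bound[OF cont_measurable[OF p(1)], of ?s] by simp
  with pos show ?thesis by (simp add: power2_eq_square)
qed

text \<open>Polarization: \<open>h * h\<close> and \<open>(h + p) * (h + p)\<close> are multiples of \<open>p\<close> for self-adjoint \<open>h\<close>, hence so is \<open>h\<close>.\<close>

lemma minimal_idempotent_multiple:
  assumes p: "cont p" "star p = p" "conv p p = p"
    and min: "\<And>q x1. cont q \<Longrightarrow> star q = q \<Longrightarrow> conv q q = q \<Longrightarrow> q x1 \<noteq> 0 \<Longrightarrow> conv p q = q \<Longrightarrow> q = p"
    and f: "cont f" "conv p f = f" "conv f p = f"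
  shows "\<exists>c. f = (\<lambda>x. c * p x)"
proof -
  have square: "\<exists>c::complex. conv h h = (\<lambda>x. c * p x)"
    if h: "cont h" "star h = h" "conv p h = h" for h
  proof (cases "\<exists>x. h x \<noteq> 0")
    case False
    then show ?thesis by (intro exI[of _ 0]) (simp add: conv_def fun_eq_iff)
  next
    case True
    then obtain x0 where x0: "h x0 \<noteq> 0" ..
    obtain q and L :: real where q: "cont q" "star q = q" "conv q q = q" "q 0 \<noteq> 0" "0 < L"
      "conv (conv h h) q = (\<lambda>x. of_real L * q x)"
      "\<forall>p. cont p \<and> conv p h = h \<longrightarrow> conv p q = q"
      by (rule power_iteration[OF h(1,2) x0]) blast
    \<comment> \<open>Minimality identifies the spectral projection with \<open>p\<close>, so the
      eigenvalue equation determines \<open>conv h h\<close> itself.\<close>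
    have qp: "q = p" by (rule min[OF q(1-4)]) (use q(7) p(1) h(3) in blast)
    have "conv h p = h"
      using star_conv[OF p(1) h(1)] by (simp add: h p(2))
    then have "conv (conv h h) p = conv h h"
      by (simp add: conv_assoc[OF h(1) h(1) p(1)])
    with q(6) show ?thesis unfolding qp by metis
  qed
  have multiple: "\<exists>c::complex. h = (\<lambda>x. c * p x)"
    if h: "cont h" "star h = h" "conv p h = h" for h
  proof -
    let ?k = "\<lambda>x. h x + p x"
    have k: "cont ?k" by (intro continuous_on_add h p)
    have hp: "conv h p = h"
      using star_conv[OF p(1) h(1)] by (simp add: h p(2))
    have "star ?k = ?k"
      using fun_cong[OF h(2)] fun_cong[OF p(2)] by (simp add: star_def fun_eq_iff)
    moreover have "conv p ?k = ?k" by (simp add: conv_add_right[OF h(1) p(1) p(1)] h p)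
    ultimately obtain c where c: "conv ?k ?k = (\<lambda>x. c * p x)" using square[OF k] by blast
    obtain d where d: "conv h h = (\<lambda>x. d * p x)" using square[OF h] by blast
    have "conv ?k ?k = (\<lambda>x. conv h h x + h x + (h x + p x))"
      by (simp add: conv_add_left[OF h(1) p(1) k] conv_add_right[OF h(1) p(1) h(1)]
            conv_add_right[OF h(1) p(1) p(1)] hp h p(3))
    \<comment> \<open>The convolution square of \<open>h + p\<close> is \<open>conv h h\<close> plus
      twice \<open>h\<close> plus \<open>p\<close>; comparing multiples of \<open>p\<close> solves
      for \<open>h\<close>.\<close>
    then have "h x = ((c - d - 1) / 2) * p x" for x
      unfolding c d by (auto simp: fun_eq_iff field_simps dest!: spec[of _ x])
    then show ?thesis by blast
  qed
  let ?g = "star f"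
  have g: "cont ?g" by (rule cont_star[OF f(1)])
  \<comment> \<open>Adjoints turn right absorption of \<open>f\<close> into left absorption of
    \<open>star f\<close>, so the self-adjoint case covers both parts of \<open>f\<close>.\<close>
  have pg: "conv p ?g = ?g" using star_conv[OF f(1) p(1)] by (simp add: f(3) p(2))
  have "\<exists>c::complex. (\<lambda>x. f x + ?g x) = (\<lambda>x. c * p x)"
  proof (rule multiple)
    show "cont (\<lambda>x. f x + ?g x)" by (intro continuous_on_add f g)
    show "star (\<lambda>x. f x + ?g x) = (\<lambda>x. f x + ?g x)" by (simp add: star_def fun_eq_iff)
    show "conv p (\<lambda>x. f x + ?g x) = (\<lambda>x. f x + ?g x)"
      by (simp add: conv_add_right[OF f(1) g p(1)] f pg)
  qed
  then obtain a where a: "\<And>x. f x + ?g x = a * p x" by metis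
  have "\<exists>c::complex. (\<lambda>x. \<i> * (f x - ?g x)) = (\<lambda>x. c * p x)"
  proof (rule multiple)
    show "cont (\<lambda>x. \<i> * (f x - ?g x))" by (intro continuous_on_mult continuous_on_const continuous_on_diff f g)
    show "star (\<lambda>x. \<i> * (f x - ?g x)) = (\<lambda>x. \<i> * (f x - ?g x))" by (simp add: star_def fun_eq_iff algebra_simps)
    show "conv p (\<lambda>x. \<i> * (f x - ?g x)) = (\<lambda>x. \<i> * (f x - ?g x))"
      by (simp add: conv_cmult_right conv_diff_right[OF f(1) g p(1)] f pg)
  qed
  then obtain b where b: "\<And>x. \<i> * (f x - ?g x) = b * p x" by metis
  have "f x = ((a - \<i> * b) / 2) * p x" for x
  proof -
    have "2 * f x = (f x + ?g x) - \<i> * (\<i> * (f x - ?g x))" by (simp add: algebra_simps flip: mult.assoc)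
    then show ?thesis unfolding a b by (simp add: algebra_simps)
  qed
  then show ?thesis by blast
qed

text \<open>An idempotent \<open>q\<close> strictly below \<open>p\<close> leaves the idempotent
  \<open>p - q\<close>, of squared norm at least 1. Squared norms are values at 0 and therefore add
  up, so induction on an integer bound reaches a minimal idempotent. The relation
  \<open>conv p \<gamma> = \<gamma>\<close> is inherited upwards and later ties \<gamma> to an
  eigenspace.\<close>

lemma idempotent_character:
  assumes "cont p" "star p = p" "conv p p = p" "p x0 \<noteq> 0"
  shows "\<exists>\<gamma>\<in>dual_group. conv p \<gamma> = \<gamma>"
proof -
  have "sq_norm m p \<le> real n \<Longrightarrow> ?thesis" for n
    using assms
  proof (induction n arbitrary: p x0)
    case 0
    with idempotent_ge_1[of p x0] show ?case by simp
  next
    case (Suc n)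
    note p = Suc.prems(2-5)
    show ?case
    proof (cases "\<exists>q x1. cont q \<and> star q = q \<and> conv q q = q \<and> q x1 \<noteq> 0 \<and> conv p q = q \<and> q \<noteq> p")
      case True
      then obtain q x1 where q: "cont q" "star q = q" "conv q q = q" "q x1 \<noteq> 0" "conv p q = q" "q \<noteq> p"
        by blast
      let ?d = "\<lambda>x. p x - q x"
      have d: "cont ?d" by (intro continuous_on_diff p q)
      have sd: "star ?d = ?d"
        using fun_cong[OF p(2)] fun_cong[OF q(2)] by (simp add: star_def fun_eq_iff)
      have "conv q p = q" using star_conv[OF p(1) q(1)] by (simp add: p(2) q)
      then have dd: "conv ?d ?d = ?d"
        by (simp add: conv_diff_left[OF p(1) q(1) d] conv_diff_right[OF p(1) q(1) p(1)]
              conv_diff_right[OF p(1) q(1) q(1)] p(3) q)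
      obtain y where "p y \<noteq> q y" using q(6) by (metis ext)
      then have "?d y \<noteq> 0" by simp
      from idempotent_ge_1[OF d sd dd this] have "1 \<le> sq_norm m ?d" .
      moreover have "of_real (sq_norm m ?d) = (of_real (sq_norm m p - sq_norm m q) :: complex)"
        using idempotent_at_0[OF d sd dd] idempotent_at_0[OF p(1-3)] idempotent_at_0[OF q(1-3)] by simp
      ultimately have "sq_norm m q \<le> real n"
        using Suc.prems(1) by (simp only: of_real_eq_iff)
      from Suc.IH[OF this q(1-4)] obtain \<gamma> where \<gamma>: "\<gamma> \<in> dual_group" "conv q \<gamma> = \<gamma>" by blast
      have "conv p \<gamma> = \<gamma>"
        using conv_assoc[OF p(1) q(1) dual_groupD(1)[OF \<gamma>(1)]] by (simp add: \<gamma>(2) q(5))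
      with \<gamma>(1) show ?thesis by blast
    next
      case False
      \<comment> \<open>Translates of a minimal \<open>p\<close> are multiples of it, which makes
        \<open>p\<close> multiplicative once divided by its value at 0.\<close>
      have "\<exists>c. (\<lambda>x. p (x + a)) = (\<lambda>x. c * p x)" for a
      proof (rule minimal_idempotent_multiple[OF p(1-3)])
        show "cont (\<lambda>x. p (x + a))" by (rule cont_compose[OF p(1)]) (intro continuous_intros)
        show "conv p (\<lambda>x. p (x + a)) = (\<lambda>x. p (x + a))"
          by (simp add: conv_translate_right[OF p(1) p(1)] p(3))
        show "conv (\<lambda>x. p (x + a)) p = (\<lambda>x. p (x + a))"
          by (simp add: conv_translate_left p(3))
      qed (use False in blast)
      then obtain c where c: "\<And>x a. p (x + a) = c a * p x" by metis
      define s where "s = sq_norm m p"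
      have s: "p 0 = of_real s" "0 < s"
        using idempotent_at_0[OF p(1-3)] sq_norm_pos[OF p(1,4)] by (simp_all add: s_def)
      define \<gamma> where "\<gamma> = (\<lambda>x. p x / of_real s)"
      have c_eq: "c a = \<gamma> a" for a
        using c[of 0 a] s by (simp add: \<gamma>_def)
      have mult: "\<gamma> (x + y) = \<gamma> x * \<gamma> y" for x y
        using c[of x y] by (simp add: c_eq \<gamma>_def)
      \<comment> \<open>Self-adjointness makes inversion act as conjugation, so the squared modulus
        at \<open>x\<close> is the value at \<open>x + - x\<close>, which is 1.\<close>
      have "\<gamma> (- x) = cnj (\<gamma> x)" for x
        using fun_cong[OF p(2), of "- x"] by (simp add: star_def \<gamma>_def)
      then have "of_real ((norm (\<gamma> x))\<^sup>2) = \<gamma> (x + - x)" for x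
        unfolding mult complex_norm_square by simp
      then have "of_real ((norm (\<gamma> x))\<^sup>2) = (of_real 1 :: complex)" for x
        using s by (simp add: \<gamma>_def)
      then have "(norm (\<gamma> x))\<^sup>2 = 1" for x
        by (simp only: of_real_eq_iff)
      then have "norm (\<gamma> x) = 1" for x
        by (simp add: abs_square_eq_1)
      moreover have "cont \<gamma>" unfolding \<gamma>_def using s(2) by (intro continuous_intros p) auto
      ultimately have "\<gamma> \<in> dual_group" using mult by (simp add: dual_group_def)
      moreover have "conv p \<gamma> = \<gamma>"
        using conv_cmult_right[of p "1 / of_real s" p] by (simp add: p(3) \<gamma>_def)
      ultimately show ?thesis by blast
    qed
  qed
  with real_arch_simple[of "sq_norm m p"] show ?thesis by blast
qed

text \<open>Put \<open>h = conv g (star g)\<close>. If all coefficients vanished, a character fixed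
  by \<open>q\<close> would be annihilated by convolution with \<open>g\<close>, hence with
  \<open>conv h h\<close>, which acts on it as multiplication by \<open>L > 0\<close>.\<close>

lemma Fourier_coefficient_nonzero:
  assumes g: "cont g" "g x0 \<noteq> 0"
  shows "\<exists>\<gamma>\<in>dual_group. (\<integral>y. cnj (\<gamma> y) * g y \<partial>m) \<noteq> 0"
proof (rule ccontr)
  assume *: "\<not> ?thesis"
  let ?h = "conv g (star g)"
  have sg: "cont (star g)" by (rule cont_star[OF g(1)])
  have h: "cont ?h" by (rule cont_conv[OF g(1) sg])
  have sh: "star ?h = ?h" by (simp add: star_conv[OF g(1) sg])
  have "star g (- x0) \<noteq> 0" using g(2) by (simp add: star_def)
  from sq_norm_pos[OF sg this] have h0: "?h 0 \<noteq> 0"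
    using conv_star_self_0[of "star g"] by simp
  obtain q and L :: real where q: "cont q" "star q = q" "conv q q = q" "q 0 \<noteq> 0" "0 < L"
    "conv (conv ?h ?h) q = (\<lambda>x. of_real L * q x)"
    by (rule power_iteration[OF h sh h0]) blast
  obtain \<gamma> where \<gamma>: "\<gamma> \<in> dual_group" "conv q \<gamma> = \<gamma>"
    using idempotent_character[OF q(1-4)] by blast
  note cont\<gamma> = dual_groupD(1)[OF \<gamma>(1)]
  have s\<gamma>: "star \<gamma> = \<gamma>" by (simp add: star_def dual_groupD(5)[OF \<gamma>(1)] fun_eq_iff)
  have "conv \<gamma> g x = \<gamma> x * (\<integral>y. cnj (\<gamma> y) * g y \<partial>m)" for x
    by (simp add: conv_def dual_groupD(6)[OF \<gamma>(1)] mult.assoc)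
  with * \<gamma>(1) have "conv \<gamma> g = (\<lambda>_. 0)" by (auto simp: fun_eq_iff)
  then have "conv \<gamma> ?h = (\<lambda>_. 0)"
    using conv_assoc[OF cont\<gamma> g(1) sg] by (simp add: conv_zero_left)
  then have "conv \<gamma> (conv ?h ?h) = (\<lambda>_. 0)"
    using conv_assoc[OF cont\<gamma> h h] by (simp add: conv_zero_left)
  \<comment> \<open>Taking adjoints moves \<gamma> to the right, since both factors are
    self-adjoint.\<close>
  then have 0: "conv (conv ?h ?h) \<gamma> = (\<lambda>_. 0)"
    using star_conv[OF cont\<gamma> cont_conv[OF h h]] star_conv[OF h h]
    by (simp add: s\<gamma> sh) (simp add: star_def fun_eq_iff)
  have "conv (conv ?h ?h) \<gamma> = (\<lambda>x. of_real L * \<gamma> x)"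
    using conv_assoc[OF cont_conv[OF h h] q(1) cont\<gamma>] by (simp add: \<gamma>(2) q(6) conv_cmult_left)
  from fun_cong[OF this, of 0] show False
    using q(5) by (simp add: 0 dual_groupD(4)[OF \<gamma>(1)])
qed

lemma Urysohn_cont:
  assumes "closed S" "closed T" "S \<inter> T = {}"
  obtains f :: "'a \<Rightarrow> real" where "continuous_on UNIV f" "\<And>x. 0 \<le> f x" "\<And>x. f x \<le> 1"
    "\<And>x. x \<in> S \<Longrightarrow> f x = 0" "\<And>x. x \<in> T \<Longrightarrow> f x = 1"
proof -
  have "compact_space (euclidean :: 'a topology)"
    using compact_UNIV by (simp add: compact_space_def)
  moreover have "Hausdorff_space (euclidean :: 'a topology)"
    unfolding Hausdorff_space_def by (metis disjnt_def hausdorff open_openin)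
  ultimately have "normal_space (euclidean :: 'a topology)"
    using compact_Hausdorff_or_regular_imp_normal_space by blast
  then obtain f where f: "continuous_map euclidean (top_of_set {0..1::real}) f" "f ` S \<subseteq> {0}" "f ` T \<subseteq> {1}"
    using Urysohn_lemma[of euclidean S T 0 1] assms by (auto simp: disjnt_def)
  from f(1) have "continuous_on UNIV f" "\<And>x. f x \<in> {0..1}"
    by (auto simp: continuous_map_in_subtopology)
  with f(2,3) show thesis by (intro that[of f]) auto
qed

text \<open>If all characters agreed at \<open>x\<close> and \<open>y\<close>, they would be
  invariant under translation by \<open>a = x - y\<close>. Then any continuous function minus its
  translate by \<open>a\<close> would have only zero coefficients and vanish, contrary to a Urysohn
  function separating 0 from \<open>a\<close>.\<close>

lemma characters_separate_points:
  fixes x y :: 'a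
  assumes "x \<noteq> y"
  shows "\<exists>\<gamma>\<in>dual_group. \<gamma> x \<noteq> \<gamma> y"
proof (rule ccontr)
  assume *: "\<not> ?thesis"
  define a where "a = x - y"
  obtain f :: "'a \<Rightarrow> real" where f: "continuous_on UNIV f" "f 0 = 0" "f a = 1"
    by (rule Urysohn_cont[of "{0}" "{a}"]) (use assms in \<open>auto simp: a_def\<close>)
  let ?F = "\<lambda>z. complex_of_real (f z)"
  let ?G = "\<lambda>z. ?F z - ?F (z + a)"
  have F: "cont ?F" by (intro continuous_intros f)
  have Fa: "cont (\<lambda>z. ?F (z + a))" by (rule cont_compose[OF F]) (intro continuous_intros)
  have "?G 0 \<noteq> 0" using f by simp
  moreover have "cont ?G" by (intro continuous_on_diff F Fa)
  ultimately obtain \<gamma> where \<gamma>: "\<gamma> \<in> dual_group" "(\<integral>z. cnj (\<gamma> z) * ?G z \<partial>m) \<noteq> 0"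
    using Fourier_coefficient_nonzero by blast
  have "\<gamma> a = 1"
    using * \<gamma>(1) dual_groupD[OF \<gamma>(1)] by (metis a_def cancel_comm_monoid_add_class.diff_cancel)
  then have \<gamma>a: "\<gamma> (z + a) = \<gamma> z" for z by (simp add: dual_groupD(3)[OF \<gamma>(1)])
  have c: "cont (\<lambda>z. cnj (\<gamma> z) * ?F z)" "cont (\<lambda>z. cnj (\<gamma> z) * ?F (z + a))"
    by (intro continuous_on_mult continuous_on_cnj F Fa dual_groupD(1)[OF \<gamma>(1)])+
  have "(\<integral>z. cnj (\<gamma> (z + a)) * ?F (z + a) \<partial>m) = (\<integral>z. cnj (\<gamma> z) * ?F z \<partial>m)"
    by (rule integral_translate[OF cont_measurable[OF c(1)]])
  then have "(\<integral>z. cnj (\<gamma> z) * ?G z \<partial>m) = 0"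
    using c[THEN cont_integrable] by (simp add: right_diff_distrib \<gamma>a)
  with \<gamma>(2) show False by simp
qed

section \<open>Trigonometric polynomials and Stone--Weierstrass\<close>

inductive trig_poly :: "('a \<Rightarrow> complex) \<Rightarrow> bool" where
  trig_char: "\<gamma> \<in> dual_group \<Longrightarrow> trig_poly \<gamma>"
| trig_add: "trig_poly f \<Longrightarrow> trig_poly g \<Longrightarrow> trig_poly (\<lambda>x. f x + g x)"
| trig_cmult: "trig_poly f \<Longrightarrow> trig_poly (\<lambda>x. c * f x)"

lemma trig_cont: "trig_poly f \<Longrightarrow> cont f"
  by (induction rule: trig_poly.induct) (auto intro: continuous_on_add continuous_on_mult continuous_on_const dest: dual_groupD(1))

lemma trig_mult:
  assumes "trig_poly f" "trig_poly g"
  shows "trig_poly (\<lambda>x. f x * g x)"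
  using assms(1)
proof (induction rule: trig_poly.induct)
  case (trig_char \<gamma>)
  from assms(2) show ?case
  proof (induction rule: trig_poly.induct)
    case (trig_char \<delta>)
    with \<open>\<gamma> \<in> dual_group\<close> show ?case by (intro trig_poly.trig_char dual_group_mult)
  next
    case (trig_add f g)
    from trig_poly.trig_add[OF trig_add.IH] show ?case by (simp add: distrib_left)
  next
    case (trig_cmult f c)
    from trig_poly.trig_cmult[OF trig_cmult.IH, of c] show ?case by (simp add: mult.left_commute)
  qed
next
  case (trig_add f g)
  from trig_poly.trig_add[OF trig_add.IH] show ?case by (simp add: distrib_right)
next
  case (trig_cmult f c)
  from trig_poly.trig_cmult[OF trig_cmult.IH, of c] show ?case by (simp add: mult.assoc)
qed

text \<open>The real Stone--Weierstrass theorem is applied to the real functions whose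
  complexification is a trigonometric polynomial. Real and imaginary parts of characters belong to
  them because conjugates of characters are characters.\<close>

lemma trig_approx:
  fixes f :: "'a \<Rightarrow> real"
  assumes "continuous_on UNIV f" "0 < e"
  obtains t where "trig_poly t" "\<And>x. norm (of_real (f x) - t x) < e"
proof -
  interpret R: function_ring_on "{f. trig_poly (\<lambda>x. complex_of_real (f x))}" UNIV
  proof
    fix f g :: "'a \<Rightarrow> real"
    assume f: "f \<in> {f. trig_poly (\<lambda>x. complex_of_real (f x))}"
    show "continuous_on UNIV f"
      using continuous_on_Re[OF trig_cont, of "\<lambda>x. complex_of_real (f x)"] f by simp
    assume g: "g \<in> {f. trig_poly (\<lambda>x. complex_of_real (f x))}"
    show "(\<lambda>x. f x + g x) \<in> {f. trig_poly (\<lambda>x. complex_of_real (f x))}"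
      "(\<lambda>x. f x * g x) \<in> {f. trig_poly (\<lambda>x. complex_of_real (f x))}"
      using f g by (auto dest: trig_add trig_mult)
  next
    fix c :: real
    show "(\<lambda>_. c) \<in> {f. trig_poly (\<lambda>x. complex_of_real (f x))}"
      using trig_cmult[OF trig_char[OF dual_group_one], of "of_real c"] by simp
  next
    fix x y :: 'a
    assume "x \<noteq> y"
    then obtain \<gamma> where \<gamma>: "\<gamma> \<in> dual_group" "\<gamma> x \<noteq> \<gamma> y" using characters_separate_points by blast
    have comb: "trig_poly (\<lambda>x. a * \<gamma> x + b * cnj (\<gamma> x))" for a b
      by (intro trig_add trig_cmult trig_char \<gamma> dual_group_cnj)
    have "(\<lambda>x. 1/2 * \<gamma> x + 1/2 * cnj (\<gamma> x)) = (\<lambda>x. complex_of_real (Re (\<gamma> x)))"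
      "(\<lambda>x. - \<i>/2 * \<gamma> x + \<i>/2 * cnj (\<gamma> x)) = (\<lambda>x. complex_of_real (Im (\<gamma> x)))"
      by (auto simp: fun_eq_iff complex_eq_iff)
    with comb[of "1/2" "1/2"] comb[of "- \<i>/2" "\<i>/2"]
    have "trig_poly (\<lambda>x. complex_of_real (Re (\<gamma> x)))" "trig_poly (\<lambda>x. complex_of_real (Im (\<gamma> x)))"
      by simp_all
    with \<gamma>(2) show "\<exists>f\<in>{f. trig_poly (\<lambda>x. complex_of_real (f x))}. f x \<noteq> f y"
      by (metis complex_eqI mem_Collect_eq)
  qed (simp add: compact_UNIV)
  obtain g where "trig_poly (\<lambda>x. complex_of_real (g x))" "\<And>x. \<bar>f x - g x\<bar> < e"
    using R.Stone_Weierstrass_basic[OF assms] by auto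
  then show thesis
    by (intro that[of "\<lambda>x. complex_of_real (g x)"]) (auto simp flip: of_real_diff)
qed

end

section \<open>Invariance and mixing of the skew product\<close>

context compact_haar
begin

lemma integral_character:
  assumes "\<gamma> \<in> dual_group" "\<gamma> \<noteq> (\<lambda>_. 1)"
  shows "(\<integral>x. \<gamma> x \<partial>m) = 0"
proof -
  obtain a where a: "\<gamma> a \<noteq> 1" using assms(2) by blast
  have "(\<integral>x. \<gamma> (x + a) \<partial>m) = (\<integral>x. \<gamma> x \<partial>m)"
    by (rule integral_translate[OF cont_measurable[OF dual_groupD(1)[OF assms(1)]]])
  then have "(\<integral>x. \<gamma> x \<partial>m) * \<gamma> a = (\<integral>x. \<gamma> x \<partial>m)"
    by (simp add: dual_groupD(3)[OF assms(1)])
  with a show ?thesis by simp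
qed

section \<open>Invariance of Haar measure under epimorphisms\<close>

lemma integrable_real_cont:
  fixes f :: "'a \<Rightarrow> real"
  assumes "continuous_on UNIV f"
  shows "integrable m f"
proof -
  have "cont (\<lambda>x. complex_of_real (f x))" by (intro continuous_intros assms)
  from integrable_Re[OF cont_integrable[OF this]] show ?thesis by simp
qed

lemma measure_le_integral:
  fixes f :: "'a \<Rightarrow> real"
  assumes "K \<in> sets m" "integrable m f" "\<And>x. 0 \<le> f x" "\<And>x. x \<in> K \<Longrightarrow> f x = 1"
  shows "measure m K \<le> (\<integral>x. f x \<partial>m)"
proof -
  have "(\<integral>x. indicator K x \<partial>m) \<le> (\<integral>x. f x \<partial>m)"
    using assms by (intro integral_mono integrable_real_indicator)
      (auto simp: indicator_def less_top[symmetric])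
  then show ?thesis using assms(1) by simp
qed

lemma integral_le_measure:
  fixes f :: "'a \<Rightarrow> real"
  assumes "U \<in> sets m" "integrable m f" "\<And>x. f x \<le> 1" "\<And>x. x \<notin> U \<Longrightarrow> f x = 0"
  shows "(\<integral>x. f x \<partial>m) \<le> measure m U"
proof -
  have "(\<integral>x. f x \<partial>m) \<le> (\<integral>x. indicator U x \<partial>m)"
    using assms by (intro integral_mono integrable_real_indicator)
      (auto simp: indicator_def less_top[symmetric])
  then show ?thesis using assms(1) by simp
qed

lemma Urysohn_cutoff:
  assumes "compact K" "open U" "K \<subseteq> U"
  obtains f :: "'a \<Rightarrow> real" where "continuous_on UNIV f" "\<And>x. 0 \<le> f x" "\<And>x. f x \<le> 1"
    "\<And>x. x \<notin> U \<Longrightarrow> f x = 0" "\<And>x. x \<in> K \<Longrightarrow> f x = 1"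
proof (rule Urysohn_cont[of "- U" K])
  show "closed (- U)" "closed K" "- U \<inter> K = {}"
    using assms by (auto intro: compact_imp_closed)
qed (use that in auto)

lemma compact_in_sets: "compact K \<Longrightarrow> K \<in> sets m"
  by (simp add: sets_m compact_imp_closed)

lemma open_in_sets: "open U \<Longrightarrow> U \<in> sets m"
  by (simp add: sets_m)

text \<open>Inner regularity in the form used below; with Urysohn functions it carries identities
  between integrals of continuous functions over to open sets.\<close>

lemma open_measure_le:
  assumes "open U" "\<And>K. compact K \<Longrightarrow> K \<subseteq> U \<Longrightarrow> measure m K \<le> c"
  shows "measure m U \<le> c"
proof -
  \<comment> \<open>\<open>ennreal\<close> sends negative numbers to 0, so the sign of
    \<open>c\<close> must be known; the empty compact set provides it.\<close>
  have "0 \<le> c" using assms(2)[of "{}"] by simp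
  have "emeasure m U = (SUP K\<in>{K. compact K \<and> K \<subseteq> U}. emeasure m K)"
    using haar assms(1) unfolding haar_probability_def by blast
  also have "\<dots> \<le> ennreal c"
    using assms(2) by (intro SUP_least) (auto simp: emeasure_eq_measure intro: ennreal_leI)
  finally show ?thesis using \<open>0 \<le> c\<close> by (simp add: emeasure_eq_measure)
qed

lemma Epi_measurable: "\<tau> \<in> Epi \<Longrightarrow> \<tau> \<in> measurable m m"
  by (simp add: Epi_def borel_measurable_continuous_onI measurable_cong_sets[OF sets_m sets_m])

text \<open>Surjectivity of \<tau> keeps \<open>\<gamma> \<circ> \<tau>\<close> nontrivial for
  nontrivial \<gamma>, so both integrals vanish on such characters; uniform approximation does the
  rest.\<close>

lemma Epi_cont_integral:
  fixes f :: "'a \<Rightarrow> real"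
  assumes \<tau>: "\<tau> \<in> Epi" and f: "continuous_on UNIV f"
  shows "(\<integral>x. f (\<tau> x) \<partial>m) = (\<integral>x. f x \<partial>m)"
proof -
  have cont\<tau>: "continuous_on UNIV \<tau>" and surj: "surj \<tau>" using \<tau> by (auto simp: Epi_def)
  have trig: "(\<integral>x. t (\<tau> x) \<partial>m) = (\<integral>x. t x \<partial>m)" if "trig_poly t" for t
    using that
  proof (induction rule: trig_poly.induct)
    case (trig_char \<gamma>)
    show ?case
    proof (cases "\<gamma> = (\<lambda>_. 1)")
      case False
      then have "\<gamma> \<circ> \<tau> \<noteq> (\<lambda>_. 1)"
        using surj by (metis comp_apply ext surjD)
      from integral_character[OF dual_group_comp_Epi[OF trig_char \<tau>] this]
      show ?thesis by (simp add: integral_character[OF trig_char False])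
    qed simp
  next
    case (trig_add f g)
    have "cont (\<lambda>x. f (\<tau> x))" "cont (\<lambda>x. g (\<tau> x))"
      by (intro cont_compose[OF trig_cont[OF trig_add(1)] cont\<tau>] cont_compose[OF trig_cont[OF trig_add(2)] cont\<tau>])+
    with trig_add show ?case by (simp add: cont_integrable trig_cont)
  qed simp
  define I where "I = (\<integral>x. f (\<tau> x) \<partial>m) - (\<integral>x. f x \<partial>m)"
  have int: "integrable m (\<lambda>x. complex_of_real (f x))" "integrable m (\<lambda>x. complex_of_real (f (\<tau> x)))"
    by (intro cont_integrable continuous_on_of_real f continuous_on_compose2[OF f cont\<tau>] subset_UNIV)+
  have "\<bar>I\<bar> \<le> 0 + e" if "0 < e" for e
  proof -
    obtain t where t: "trig_poly t" "\<And>x. norm (of_real (f x) - t x) < e / 2"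
      using trig_approx[OF f, of "e / 2"] \<open>0 < e\<close> by auto
    have tint: "integrable m t" "integrable m (\<lambda>x. t (\<tau> x))"
      by (intro cont_integrable trig_cont[OF t(1)] cont_compose[OF trig_cont[OF t(1)] cont\<tau>])+
    have small: "norm (\<integral>x. g x \<partial>m) \<le> e / 2" if "integrable m g" "\<And>x. norm (g x) \<le> e / 2" for g :: "'a \<Rightarrow> complex"
    proof -
      have "norm (\<integral>x. g x \<partial>m) \<le> (\<integral>x. norm (g x) \<partial>m)" by (rule integral_norm_bound)
      also have "\<dots> \<le> (\<integral>x. e / 2 \<partial>m)"
        using that by (intro integral_mono) auto
      finally show ?thesis by simp
    qed
    have I: "complex_of_real I = (\<integral>x. of_real (f (\<tau> x)) - t (\<tau> x) \<partial>m) - (\<integral>x. of_real (f x) - t x \<partial>m)"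
      using int tint by (simp add: I_def trig[OF t(1)])
    have "norm (\<integral>x. of_real (f (\<tau> x)) - t (\<tau> x) \<partial>m) \<le> e / 2"
      using t(2) int tint by (intro small) (auto intro: less_imp_le)
    moreover have "norm (\<integral>x. of_real (f x) - t x \<partial>m) \<le> e / 2"
      using t(2) int tint by (intro small) (auto intro: less_imp_le)
    ultimately have "norm (complex_of_real I) \<le> e / 2 + e / 2"
      unfolding I by (intro order_trans[OF norm_triangle_ineq4 add_mono])
    then show ?thesis by simp
  qed
  then have "\<bar>I\<bar> \<le> 0" by (rule field_le_epsilon)
  then show ?thesis by (simp add: I_def)
qed

lemma Epi_measure_open:
  assumes \<tau>: "\<tau> \<in> Epi" and U: "open U"
  shows "measure m (\<tau> -` U) = measure m U"
proof (rule antisym)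
  have cont\<tau>: "continuous_on UNIV \<tau>" using \<tau> by (simp add: Epi_def)
  have oU: "open (\<tau> -` U)" using continuous_on_open_vimage[of UNIV \<tau>] cont\<tau> U by auto
  show "measure m (\<tau> -` U) \<le> measure m U"
  proof (rule open_measure_le[OF oU])
    fix K
    assume K: "compact K" "K \<subseteq> \<tau> -` U"
    have "compact (\<tau> ` K)" by (rule compact_continuous_image[OF continuous_on_subset[OF cont\<tau>] K(1)]) simp
    then obtain f :: "'a \<Rightarrow> real" where f: "continuous_on UNIV f" "\<And>x. 0 \<le> f x" "\<And>x. f x \<le> 1"
      "\<And>x. x \<notin> U \<Longrightarrow> f x = 0" "\<And>x. x \<in> \<tau> ` K \<Longrightarrow> f x = 1"
      using Urysohn_cutoff[OF _ U, of "\<tau> ` K"] K(2) by auto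
    have "measure m K \<le> (\<integral>x. f (\<tau> x) \<partial>m)"
      using f by (intro measure_le_integral compact_in_sets K integrable_real_cont continuous_on_compose2[OF f(1) cont\<tau>]) auto
    also have "\<dots> = (\<integral>x. f x \<partial>m)" by (rule Epi_cont_integral[OF \<tau> f(1)])
    also have "\<dots> \<le> measure m U"
      using f by (intro integral_le_measure open_in_sets U integrable_real_cont) auto
    finally show "measure m K \<le> measure m U" .
  qed
  show "measure m U \<le> measure m (\<tau> -` U)"
  proof (rule open_measure_le[OF U])
    fix K
    assume K: "compact K" "K \<subseteq> U"
    obtain f :: "'a \<Rightarrow> real" where f: "continuous_on UNIV f" "\<And>x. 0 \<le> f x" "\<And>x. f x \<le> 1"
      "\<And>x. x \<notin> U \<Longrightarrow> f x = 0" "\<And>x. x \<in> K \<Longrightarrow> f x = 1"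
      by (rule Urysohn_cutoff[OF K(1) U K(2)]) blast
    have "measure m K \<le> (\<integral>x. f x \<partial>m)"
      using f by (intro measure_le_integral compact_in_sets K integrable_real_cont) auto
    also have "\<dots> = (\<integral>x. f (\<tau> x) \<partial>m)" by (rule Epi_cont_integral[OF \<tau> f(1), symmetric])
    also have "\<dots> \<le> measure m (\<tau> -` U)"
      using f by (intro integral_le_measure open_in_sets oU integrable_real_cont continuous_on_compose2[OF f(1) cont\<tau>]) auto
    finally show "measure m K \<le> measure m (\<tau> -` U)" .
  qed
qed

lemma sets_m_sigma: "sets m = sigma_sets UNIV {U :: 'a set. open U}"
  by (simp add: sets_m borel_def)

lemma Epi_preserves:
  assumes "\<tau> \<in> Epi"
  shows "distr m m \<tau> = m"
proof (rule measure_eqI_generator_eq[where E="{U :: 'a set. open U}" and \<Omega>=UNIV and A="\<lambda>_. UNIV"])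
  show "Int_stable {U :: 'a set. open U}" by (simp add: Int_stable_def open_Int)
  show "emeasure (distr m m \<tau>) X = emeasure m X" if "X \<in> {U. open U}" for X
    using that Epi_measure_open[OF assms, of X] open_in_sets[of X]
    by (simp add: emeasure_distr[OF Epi_measurable[OF assms]] emeasure_eq_measure)
  show "emeasure (distr m m \<tau>) UNIV \<noteq> \<infinity>"
    using finite_measure.emeasure_finite[OF finite_measure_distr[OF Epi_measurable[OF assms]]] by simp
  show "sets (distr m m \<tau>) = sigma_sets UNIV {U. open U}" "sets m = sigma_sets UNIV {U. open U}"
    by (simp_all only: sets_distr sets_m_sigma)
qed auto

end

section \<open>The skew product and its L^2 functions\<close>

locale epimorphism_skew_product = compact_haar m
  for m :: "'a::{topological_ab_group_add, t2_space} measure" +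
  fixes \<mu> :: "(nat \<Rightarrow> 'a \<Rightarrow> 'a) measure"
  assumes space_\<mu>: "space \<mu> = {\<omega>. \<forall>n. \<omega> n \<in> Epi}"
    and eval_measurable: "(\<lambda>(\<omega>, x). \<omega> 0 x) \<in> measurable (\<mu> \<Otimes>\<^sub>M borel) borel"
    and shift_invariant: "invariant_probability \<mu> seq_shift"
begin

sublocale base: prob_space \<mu>
  using shift_invariant by (simp add: invariant_probability_def)

sublocale pair: pair_prob_space \<mu> m ..

lemma shift_measurable: "seq_shift \<in> measurable \<mu> \<mu>"
  using shift_invariant by (simp add: invariant_probability_def)

lemma space_pair: "space (\<mu> \<Otimes>\<^sub>M m) = space \<mu> \<times> UNIV"
  by (simp add: space_pair_measure)

lemma eval_measurable_m: "(\<lambda>(\<omega>, x). \<omega> 0 x) \<in> measurable (\<mu> \<Otimes>\<^sub>M m) m"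
  using eval_measurable
  by (simp add: measurable_cong_sets[OF sets_pair_measure_cong[OF refl sets_m] sets_m])

lemma skew_product_measurable: "skew_product \<in> measurable (\<mu> \<Otimes>\<^sub>M m) (\<mu> \<Otimes>\<^sub>M m)"
proof -
  have "(\<lambda>z. (seq_shift (fst z), case z of (\<omega>, x) \<Rightarrow> \<omega> 0 x)) \<in> measurable (\<mu> \<Otimes>\<^sub>M m) (\<mu> \<Otimes>\<^sub>M m)"
    by (intro measurable_Pair measurable_compose[OF measurable_fst shift_measurable] eval_measurable_m)
  also have "(\<lambda>z. (seq_shift (fst z), case z of (\<omega>, x) \<Rightarrow> \<omega> 0 x)) = (skew_product :: _ \<Rightarrow> (nat \<Rightarrow> 'a \<Rightarrow> 'a) \<times> 'a)"
    by (auto simp: skew_product_def fun_eq_iff)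
  finally show ?thesis .
qed

text \<open>The preimage of a rectangle need not be a rectangle, but its fibre over \<omega> is
  empty or the preimage of \<open>B\<close> under \<open>\<omega> 0\<close>, of measure
  \<open>emeasure m B\<close>. Integrating over \<omega> leaves the invariance of the base.\<close>

lemma skew_product_invariant: "invariant_probability (\<mu> \<Otimes>\<^sub>M m) skew_product"
proof -
  let ?\<nu> = "\<mu> \<Otimes>\<^sub>M m"
  have "?\<nu> = distr ?\<nu> ?\<nu> skew_product"
  proof (rule pair_measure_eqI)
    fix A B
    assume A: "A \<in> sets \<mu>" and B: "B \<in> sets m"
    let ?A = "seq_shift -` A \<inter> space \<mu>"
    have A': "?A \<in> sets \<mu>" by (rule measurable_sets[OF shift_measurable A])
    have slice: "emeasure m (Pair \<omega> -` (skew_product -` (A \<times> B) \<inter> space ?\<nu>)) = emeasure m B * indicator ?A \<omega>"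
      if "\<omega> \<in> space \<mu>" for \<omega>
    proof -
      have E: "\<omega> 0 \<in> Epi" using that by (simp add: space_\<mu>)
      have "Pair \<omega> -` (skew_product -` (A \<times> B) \<inter> space ?\<nu>) = (if \<omega> \<in> ?A then \<omega> 0 -` B else {})"
        using that by (auto simp: skew_product_def space_pair)
      moreover have "emeasure m (\<omega> 0 -` B) = emeasure m B"
        using emeasure_distr[OF Epi_measurable[OF E] B] by (simp add: Epi_preserves[OF E])
      ultimately show ?thesis by simp
    qed
    have "emeasure (distr ?\<nu> ?\<nu> skew_product) (A \<times> B) = emeasure ?\<nu> (skew_product -` (A \<times> B) \<inter> space ?\<nu>)"
      using A B by (intro emeasure_distr skew_product_measurable) auto
    also have "\<dots> = (\<integral>\<^sup>+\<omega>. emeasure m (Pair \<omega> -` (skew_product -` (A \<times> B) \<inter> space ?\<nu>)) \<partial>\<mu>)"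
      using A B by (intro emeasure_pair_measure_alt measurable_sets[OF skew_product_measurable]) auto
    also have "\<dots> = (\<integral>\<^sup>+\<omega>. emeasure m B * indicator ?A \<omega> \<partial>\<mu>)"
      by (intro nn_integral_cong slice)
    also have "\<dots> = emeasure m B * emeasure \<mu> ?A"
      by (rule nn_integral_cmult_indicator[OF A'])
    also have "emeasure \<mu> ?A = emeasure \<mu> A"
      using emeasure_distr[OF shift_measurable A] shift_invariant by (simp add: invariant_probability_def)
    finally show "emeasure \<mu> A * emeasure m B = emeasure (distr ?\<nu> ?\<nu> skew_product) (A \<times> B)"
      by (simp add: mult.commute)
  qed (simp_all add: sigma_finite_measure_axioms base.sigma_finite_measure_axioms)
  then show ?thesis
    by (simp add: invariant_probability_def skew_product_measurable pair.prob_space_axioms)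
qed

lemma shift_funpow: "(seq_shift ^^ n) \<omega> = (\<lambda>k. \<omega> (n + k))"
  by (induction n arbitrary: \<omega>) (auto simp: seq_shift_def fun_eq_iff)

lemma skew_funpow: "(skew_product ^^ n) (\<omega>, x) = ((seq_shift ^^ n) \<omega>, comp_upto \<omega> n x)"
  by (induction n) (simp_all add: skew_product_def shift_funpow)

definition elementary :: "(nat \<Rightarrow> 'a \<Rightarrow> 'a) set \<Rightarrow> ('a \<Rightarrow> complex) \<Rightarrow> (nat \<Rightarrow> 'a \<Rightarrow> 'a) \<times> 'a \<Rightarrow> complex" where
  "elementary A f z = indicator A (fst z) * f (snd z)"

lemma elementary_measurable:
  assumes "A \<in> sets \<mu>" "f \<in> borel_measurable m"
  shows "elementary A f \<in> borel_measurable (\<mu> \<Otimes>\<^sub>M m)"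
  unfolding elementary_def[abs_def]
  by (intro borel_measurable_times measurable_compose[OF measurable_fst borel_measurable_indicator[OF assms(1)]]
      measurable_compose[OF measurable_snd assms(2)])

lemma elementary_in_L2:
  assumes "A \<in> sets \<mu>" "cont f"
  shows "in_L2 (\<mu> \<Otimes>\<^sub>M m) (elementary A f)"
proof -
  obtain B where "\<And>x. norm (f x) \<le> B" using cont_bounded[OF assms(2)] by blast
  moreover from this have "0 \<le> B" using norm_ge_zero order_trans by blast
  ultimately show ?thesis
    using elementary_measurable[OF assms(1) cont_measurable[OF assms(2)]]
    by (intro in_L2_bounded[where B=B] pair.finite_measure_axioms)
       (auto simp: elementary_def indicator_def)
qed

text \<open>Open second sides form an intersection-stable generator whose members are within reach
  of inner regularity.\<close>

lemma sets_pair_sigma: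
  "sets (\<mu> \<Otimes>\<^sub>M m) = sigma_sets (space \<mu> \<times> UNIV) {A \<times> U | A U. A \<in> sets \<mu> \<and> open U}"
proof -
  have "sets (\<mu> \<Otimes>\<^sub>M m) = sets (sigma (space \<mu> \<times> space m) {A \<times> U | A U. A \<in> sets \<mu> \<and> U \<in> {U. open U}})"
  proof (rule sets_pair_eq[where Ca="{space \<mu>}" and Cb="{UNIV}"])
    show "sets \<mu> = sigma_sets (space \<mu>) (sets \<mu>)" by (simp add: sets.sigma_sets_eq)
    show "sets m = sigma_sets (space m) {U. open U}" by (simp add: sets_m_sigma)
  qed (auto dest: sets.sets_into_space)
  also have "\<dots> = sigma_sets (space \<mu> \<times> UNIV) {A \<times> U | A U. A \<in> sets \<mu> \<and> open U}"
    by (subst sets_measure_of) (auto dest: sets.sets_into_space)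
  finally show ?thesis .
qed

text \<open>Uniform approximation extends \<open>P\<close> from characters to continuous second
  factors, inner regularity to open rectangles, a Dynkin argument to all measurable sets, and
  density of simple functions to L^2.\<close>

lemma L2_induct_elementary:
  assumes F: "in_L2 (\<mu> \<Otimes>\<^sub>M m) F"
    and base: "\<And>A \<gamma>. A \<in> sets \<mu> \<Longrightarrow> \<gamma> \<in> dual_group \<Longrightarrow> P (elementary A \<gamma>)"
    and add: "\<And>f g. in_L2 (\<mu> \<Otimes>\<^sub>M m) f \<Longrightarrow> in_L2 (\<mu> \<Otimes>\<^sub>M m) g \<Longrightarrow> P f \<Longrightarrow> P g \<Longrightarrow> P (\<lambda>x. f x + g x)"
    and cmult: "\<And>f c. in_L2 (\<mu> \<Otimes>\<^sub>M m) f \<Longrightarrow> P f \<Longrightarrow> P (\<lambda>x. c * f x)"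
    and lim: "\<And>f. in_L2 (\<mu> \<Otimes>\<^sub>M m) f \<Longrightarrow>
      (\<And>e. 0 < e \<Longrightarrow> \<exists>g. in_L2 (\<mu> \<Otimes>\<^sub>M m) g \<and> P g \<and> sq_norm (\<mu> \<Otimes>\<^sub>M m) (\<lambda>x. f x - g x) < e) \<Longrightarrow> P f"
  shows "P F"
proof -
  let ?\<nu> = "\<mu> \<Otimes>\<^sub>M m"
  have trig: "P (elementary A t)" if A: "A \<in> sets \<mu>" and "trig_poly t" for A t
    using that(2)
  proof (induction rule: trig_poly.induct)
    case (trig_char \<gamma>)
    then show ?case by (rule base[OF A])
  next
    case (trig_add f g)
    have "elementary A (\<lambda>x. f x + g x) = (\<lambda>z. elementary A f z + elementary A g z)"
      by (simp add: elementary_def fun_eq_iff distrib_left)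
    then show ?case
      using add[OF elementary_in_L2[OF A trig_cont] elementary_in_L2[OF A trig_cont]] trig_add by simp
  next
    case (trig_cmult f c)
    have "elementary A (\<lambda>x. c * f x) = (\<lambda>z. c * elementary A f z)"
      by (simp add: elementary_def fun_eq_iff mult.left_commute)
    then show ?case
      using cmult[OF elementary_in_L2[OF A trig_cont]] trig_cmult by simp
  qed
  have continuous: "P (elementary A (\<lambda>x. of_real (f x)))"
    if A: "A \<in> sets \<mu>" and f: "continuous_on UNIV f" for A and f :: "'a \<Rightarrow> real"
  proof (rule lim)
    have cf: "cont (\<lambda>x. of_real (f x))" by (intro continuous_on_of_real f)
    show "in_L2 ?\<nu> (elementary A (\<lambda>x. of_real (f x)))" by (rule elementary_in_L2[OF A cf])
    fix e :: real
    assume "0 < e"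
    then have se: "0 < sqrt (e / 2)" by simp
    obtain t where t: "trig_poly t" "\<And>x. norm (of_real (f x) - t x) < sqrt (e / 2)"
      using trig_approx[OF f se] by blast
    let ?d = "\<lambda>z. elementary A (\<lambda>x. of_real (f x)) z - elementary A t z"
    have "?d \<in> borel_measurable ?\<nu>"
      by (intro borel_measurable_diff elementary_measurable A cont_measurable cf trig_cont t)
    moreover have "norm (?d z) \<le> sqrt (e / 2)" for z
      using less_imp_le[OF t(2)[of "snd z"]] se by (simp add: elementary_def indicator_def)
    ultimately have "sq_norm ?\<nu> ?d \<le> (sqrt (e / 2))\<^sup>2"
      using pair.sq_norm_le_bound[of ?d "sqrt (e / 2)"] pair.prob_space by simp
    also have "\<dots> < e" using \<open>0 < e\<close> by simp
    finally show "\<exists>g. in_L2 ?\<nu> g \<and> P g \<and> sq_norm ?\<nu> (\<lambda>z. elementary A (\<lambda>x. of_real (f x)) z - g z) < e"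
      using elementary_in_L2[OF A trig_cont[OF t(1)]] trig[OF A t(1)] by blast
  qed
  have ind_L2: "in_L2 ?\<nu> (indicator C)" if "C \<in> sets ?\<nu>" for C
    using that by (intro in_L2_bounded[where B=1] pair.finite_measure_axioms) (auto simp: indicator_def)
  \<comment> \<open>An indicator is its own square, so a pointwise bound by one turns into a bound
    of the squared norm by a measure.\<close>
  have sq_ind: "sq_norm ?\<nu> (\<lambda>z. f z - g z) \<le> measure ?\<nu> C"
    if "C \<in> sets ?\<nu>" "in_L2 ?\<nu> f" "in_L2 ?\<nu> g"
      "\<And>z. z \<in> space ?\<nu> \<Longrightarrow> norm (f z - g z) \<le> indicator C z" for C and f g :: "_ \<Rightarrow> complex"
  proof -
    have "sq_norm ?\<nu> (\<lambda>z. f z - g z) \<le> (\<integral>z. indicator C z \<partial>?\<nu>)"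
      unfolding sq_norm_def
    proof (rule integral_mono)
      show "integrable ?\<nu> (\<lambda>z. (norm (f z - g z))\<^sup>2)"
        using in_L2_diff[OF that(2,3)] by (simp add: in_L2_def)
      show "integrable ?\<nu> (indicator C :: _ \<Rightarrow> real)"
        using that(1) by (simp add: integrable_indicator_iff less_top[symmetric])
      fix z
      assume "z \<in> space ?\<nu>"
      then have "(norm (f z - g z))\<^sup>2 \<le> (indicator C z)\<^sup>2" by (intro power_mono that) auto
      then show "(norm (f z - g z))\<^sup>2 \<le> indicator C z" by (cases "z \<in> C") simp_all
    qed
    then show ?thesis using that(1) by simp
  qed
  have rectangle: "P (indicator (A \<times> U))" if A: "A \<in> sets \<mu>" and U: "open U" for A U
  proof (rule lim)
    have AU: "A \<times> U \<in> sets ?\<nu>" using A open_in_sets[OF U] by auto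
    show "in_L2 ?\<nu> (indicator (A \<times> U))" by (rule ind_L2[OF AU])
    fix e :: real
    assume "0 < e"
    \<comment> \<open>Otherwise \<open>open_measure_le\<close> would bound the measure of
      \<open>U\<close> by itself minus \<open>e\<close>.\<close>
    have "\<exists>K. compact K \<and> K \<subseteq> U \<and> measure m U - e < measure m K"
      using open_measure_le[OF U, of "measure m U - e"] \<open>0 < e\<close> by force
    then obtain K where K: "compact K" "K \<subseteq> U" "measure m U - e < measure m K" by blast
    obtain f :: "'a \<Rightarrow> real" where f: "continuous_on UNIV f" "\<And>x. 0 \<le> f x" "\<And>x. f x \<le> 1"
      "\<And>x. x \<notin> U \<Longrightarrow> f x = 0" "\<And>x. x \<in> K \<Longrightarrow> f x = 1"
      by (rule Urysohn_cutoff[OF K(1) U K(2)]) blast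
    let ?g = "elementary A (\<lambda>x. of_real (f x))"
    have g: "in_L2 ?\<nu> ?g" by (intro elementary_in_L2 A continuous_on_of_real f)
    have UK: "U - K \<in> sets m" using open_in_sets[OF U] compact_in_sets[OF K(1)] by auto
    have "sq_norm ?\<nu> (\<lambda>z. indicator (A \<times> U) z - ?g z) \<le> measure ?\<nu> (space \<mu> \<times> (U - K))"
    proof (rule sq_ind)
      show "space \<mu> \<times> (U - K) \<in> sets ?\<nu>" using UK by auto
      fix z
      assume z: "z \<in> space ?\<nu>"
      have "\<bar>indicator U x - f x\<bar> \<le> indicator (U - K) x" for x
        using f(2-5)[of x] K(2) by (auto simp: indicator_def)
      then have "norm (complex_of_real (indicator U (snd z) - f (snd z))) \<le> indicator (U - K) (snd z)"
        unfolding norm_of_real by blast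
      then show "norm (indicator (A \<times> U) z - ?g z) \<le> indicator (space \<mu> \<times> (U - K)) z"
        using z by (cases z) (auto simp: elementary_def indicator_def space_pair split: if_splits)
    qed (rule ind_L2[OF AU], rule g)
    also have "\<dots> = measure m (U - K)"
      using emeasure_pair_measure_Times[OF sets.top UK, of \<mu>]
      by (simp add: base.emeasure_space_1 measure_def)
    also have "\<dots> = measure m U - measure m K"
      by (rule finite_measure_Diff[OF open_in_sets[OF U] compact_in_sets[OF K(1)] K(2)])
    also have "\<dots> < e" using K(3) by simp
    finally show "\<exists>g. in_L2 ?\<nu> g \<and> P g \<and> sq_norm ?\<nu> (\<lambda>z. indicator (A \<times> U) z - g z) < e"
      using g continuous[OF A f(1)] by blast
  qed
  have indicator: "P (indicator C)" if "C \<in> sets ?\<nu>" for C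
  proof -
    let ?G = "{A \<times> U | A U. A \<in> sets \<mu> \<and> open (U :: 'a set)}"
    have "Int_stable ?G"
    proof (rule Int_stableI)
      fix a b
      assume "a \<in> ?G" "b \<in> ?G"
      then obtain A U A' U' where "a = A \<times> U" "b = A' \<times> U'" "A \<in> sets \<mu>" "A' \<in> sets \<mu>" "open U" "open U'"
        by blast
      then show "a \<inter> b \<in> ?G"
        by (auto intro!: exI[of _ "A \<inter> A'"] exI[of _ "U \<inter> U'"])
    qed
    moreover have "?G \<subseteq> Pow (space \<mu> \<times> UNIV)" by (auto dest: sets.sets_into_space)
    moreover have "C \<in> sigma_sets (space \<mu> \<times> UNIV) ?G" using that by (simp add: sets_pair_sigma)
    ultimately show ?thesis
    proof (induction rule: sigma_sets_induct_disjoint)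
      case (basic A)
      then show ?case using rectangle by blast
    next
      case empty
      show ?case using rectangle[OF sets.empty_sets open_UNIV] by (simp only: Sigma_empty1)
    next
      case (compl A)
      have A: "A \<in> sets ?\<nu>" using compl(1) by (simp add: sets_pair_sigma)
      have top: "space \<mu> \<times> UNIV \<in> sets ?\<nu>" using sets.top[of ?\<nu>] by (simp add: space_pair)
      \<comment> \<open>The whole space is itself an open rectangle, so complements reduce to linear
        combinations.\<close>
      have "P (\<lambda>z. indicator (space \<mu> \<times> UNIV) z + -1 * indicator A z)"
        by (intro add cmult in_L2_cmult ind_L2 A top compl rectangle sets.top open_UNIV)
      also have "(\<lambda>z. indicator (space \<mu> \<times> UNIV) z + -1 * indicator A z) =
          (indicator (space \<mu> \<times> UNIV - A) :: _ \<Rightarrow> complex)"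
        using sets.sets_into_space[OF A] by (auto simp: fun_eq_iff indicator_def space_pair)
      finally show ?case .
    next
      case (union A)
      have A: "A i \<in> sets ?\<nu>" for i using union(2) by (auto simp: sets_pair_sigma)
      let ?A = "\<Union>i. A i"
      have part: "P (\<lambda>z. \<Sum>i<n. indicator (A i) z) \<and> in_L2 ?\<nu> (\<lambda>z. \<Sum>i<n. indicator (A i) z)" for n
      proof (induction n)
        case 0
        show ?case
          using cmult[OF ind_L2[OF A] union(3), of 0 0] in_L2_cmult[OF ind_L2[OF A], of 0 0] by simp
      next
        case (Suc n)
        then show ?case unfolding sum.lessThan_Suc by (intro conjI add in_L2_add ind_L2 A union) auto
      qed
      show ?case
      proof (rule lim)
        have UA: "?A \<in> sets ?\<nu>" using A by auto
        show "in_L2 ?\<nu> (indicator ?A)" by (rule ind_L2[OF UA])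
        fix e :: real
        assume "0 < e"
        have "(\<lambda>n. \<Sum>i<n. measure ?\<nu> (A i)) \<longlonglongrightarrow> measure ?\<nu> ?A"
          using pair.finite_measure_UNION[of A] A union(1) by (auto simp: sums_def)
        then have "\<forall>\<^sub>F n in sequentially. measure ?\<nu> ?A - e < (\<Sum>i<n. measure ?\<nu> (A i))"
          using \<open>0 < e\<close> by (intro order_tendstoD(1)) auto
        then obtain n where n: "measure ?\<nu> ?A - e < (\<Sum>i<n. measure ?\<nu> (A i))"
          by (meson eventually_happens' sequentially_bot)
        let ?B = "\<Union>i<n. A i"
        have B: "?B \<in> sets ?\<nu>" using A by auto
        have mB: "measure ?\<nu> ?B = (\<Sum>i<n. measure ?\<nu> (A i))"
          using A union(1)
          by (intro pair.finite_measure_finite_Union) (auto simp: disjoint_family_on_def)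
        have sumB: "(\<Sum>i<n. indicator (A i) z) = (indicator ?B z :: complex)" for z
          using union(1) by (subst indicator_UN_disjoint) (auto simp: disjoint_family_on_def)
        \<comment> \<open>By disjointness the partial sums are indicators of finite unions; the
          error is the measure of the tail.\<close>
        have "sq_norm ?\<nu> (\<lambda>z. indicator ?A z - (\<Sum>i<n. indicator (A i) z)) \<le> measure ?\<nu> (?A - ?B)"
        proof (rule sq_ind)
          show "norm (indicator ?A z - (\<Sum>i<n. indicator (A i) z) :: complex) \<le> indicator (?A - ?B) z" for z
            unfolding sumB by (auto simp: indicator_def)
        qed (use UA B part ind_L2 in auto)
        also have "\<dots> = measure ?\<nu> ?A - measure ?\<nu> ?B"
          by (rule pair.finite_measure_Diff[OF UA B]) auto
        also have "\<dots> < e" using n mB by simp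
        finally show "\<exists>g. in_L2 ?\<nu> g \<and> P g \<and> sq_norm ?\<nu> (\<lambda>z. indicator ?A z - g z) < e"
          using part[of n] by blast
      qed
    qed
  qed
  show ?thesis
    by (rule L2_induct_indicator[OF pair.prob_space_axioms F indicator add cmult lim])
qed

lemma decay_elementary:
  assumes A: "A \<in> sets \<mu>" and B: "B \<in> sets \<mu>" and \<gamma>: "\<gamma> \<in> dual_group" and \<delta>: "\<delta> \<in> dual_group"
    and tight: "fourier_tight \<mu>" and mixing: "strongly_mixing \<mu> seq_shift"
  shows "correlations_decay (\<mu> \<Otimes>\<^sub>M m) skew_product (elementary A \<gamma>) (elementary B \<delta>)"
proof -
  let ?\<nu> = "\<mu> \<Otimes>\<^sub>M m"
  let ?F = "elementary A \<gamma>" and ?H = "elementary B \<delta>"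
  define b :: "nat \<Rightarrow> (nat \<Rightarrow> 'a \<Rightarrow> 'a) \<Rightarrow> complex"
    where "b n \<omega> = indicator A \<omega> * indicator B ((seq_shift ^^ n) \<omega>)" for n \<omega>
  define I where "I n \<omega> = (\<integral>x. \<gamma> x * \<delta> (comp_upto \<omega> n x) \<partial>m)" for n \<omega>
  have F: "in_L2 ?\<nu> ?F" and H: "in_L2 ?\<nu> ?H"
    using \<gamma> \<delta> by (auto intro: elementary_in_L2 A B dual_groupD(1))
  have int: "integrable ?\<nu> (\<lambda>z. ?F z * ?H ((skew_product ^^ n) z))" for n
    by (rule correlation_integrable[OF skew_product_invariant F H])
  have inner: "(\<integral>x. ?F (\<omega>, x) * ?H ((skew_product ^^ n) (\<omega>, x)) \<partial>m) = b n \<omega> * I n \<omega>" for n \<omega>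
  proof -
    have "?F (\<omega>, x) * ?H ((skew_product ^^ n) (\<omega>, x)) = b n \<omega> * (\<gamma> x * \<delta> (comp_upto \<omega> n x))" for x
      by (simp add: elementary_def skew_funpow b_def mult_ac)
    then show ?thesis by (simp add: I_def)
  qed
  have corr: "(\<integral>z. ?F z * ?H ((skew_product ^^ n) z) \<partial>?\<nu>) = (\<integral>\<omega>. b n \<omega> * I n \<omega> \<partial>\<mu>)" for n
    using pair.integral_fst'[OF int, of n] by (simp add: inner)
  \<comment> \<open>Fubini provides measurability of the whole fibre integral, which is all that
    dominated convergence asks for.\<close>
  have bI_meas: "(\<lambda>\<omega>. b n \<omega> * I n \<omega>) \<in> borel_measurable \<mu>" for n
    using borel_measurable_integrable[OF pair.integrable_fst'[OF int, of n]] by (simp add: inner)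
  have elem_integral: "(\<integral>z. elementary C \<eta> z \<partial>?\<nu>) = (\<integral>\<omega>. indicator C \<omega> \<partial>\<mu>) * (\<integral>x. \<eta> x \<partial>m)"
    if "C \<in> sets \<mu>" "\<eta> \<in> dual_group" for C \<eta>
    using pair.integral_fst'[OF in_L2_integrable[OF pair.prob_space_axioms
        elementary_in_L2[OF that(1) dual_groupD(1)[OF that(2)]]]]
    by (simp add: elementary_def[abs_def])
  show ?thesis
  proof (cases "\<delta> = (\<lambda>_. 1)")
    case True
    have "in_L2 \<mu> (indicator C)" if "C \<in> sets \<mu>" for C
      using that by (intro in_L2_bounded[where B=1] base.finite_measure_axioms) (auto simp: indicator_def)
    then have "(\<lambda>n. \<integral>\<omega>. b n \<omega> \<partial>\<mu>) \<longlonglongrightarrow> (\<integral>\<omega>. indicator A \<omega> \<partial>\<mu>) * (\<integral>\<omega>. indicator B \<omega> \<partial>\<mu>)"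
      unfolding b_def using mixing A B by (simp only: strongly_mixing_def)
    from tendsto_mult_right[OF this, of "\<integral>x. \<gamma> x \<partial>m"] show ?thesis
      unfolding correlations_decay_def corr elem_integral[OF A \<gamma>] elem_integral[OF B \<delta>]
      by (simp add: I_def True mult_ac)
  next
    case False
    have "(\<lambda>n. \<integral>\<omega>. b n \<omega> * I n \<omega> \<partial>\<mu>) \<longlonglongrightarrow> (\<integral>\<omega>. 0 \<partial>\<mu>)"
    proof (rule integral_dominated_convergence[where w="\<lambda>_. 1"])
      have "norm (I n \<omega>) \<le> 1" for n \<omega>
      proof -
        have "norm (I n \<omega>) \<le> (\<integral>x. norm (\<gamma> x * \<delta> (comp_upto \<omega> n x)) \<partial>m)"
          unfolding I_def by (rule integral_norm_bound)
        then show ?thesis by (simp add: norm_mult dual_groupD(2)[OF \<gamma>] dual_groupD(2)[OF \<delta>])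
      qed
      then show "AE \<omega> in \<mu>. norm (b n \<omega> * I n \<omega>) \<le> 1" for n
        by (intro AE_I2) (simp add: b_def norm_mult indicator_def)
      \<comment> \<open>Tightness is needed for one character only: the product of \<gamma> with
        another character is trivial exactly when the latter is the conjugate of \<gamma>.\<close>
      have "AE \<omega> in \<mu>. \<exists>m\<^sub>0. \<forall>n\<ge>m\<^sub>0. adjoint_map (comp_upto \<omega> n) ` (dual_group - {trivial_character})
          \<subseteq> dual_group - {\<lambda>x. cnj (\<gamma> x)}"
        using tight unfolding fourier_tight_def
        by (rule AE_mp) (use dual_group_cnj[OF \<gamma>] in \<open>auto intro!: AE_I2\<close>)
      then show "AE \<omega> in \<mu>. (\<lambda>n. b n \<omega> * I n \<omega>) \<longlonglongrightarrow> 0"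
      proof (rule AE_mp, intro AE_I2 impI)
        fix \<omega>
        assume "\<exists>m\<^sub>0. \<forall>n\<ge>m\<^sub>0. adjoint_map (comp_upto \<omega> n) ` (dual_group - {trivial_character})
          \<subseteq> dual_group - {\<lambda>x. cnj (\<gamma> x)}"
        then obtain m\<^sub>0 where m\<^sub>0: "\<And>n. m\<^sub>0 \<le> n \<Longrightarrow>
            adjoint_map (comp_upto \<omega> n) ` (dual_group - {trivial_character}) \<subseteq> dual_group - {\<lambda>x. cnj (\<gamma> x)}"
          by blast
        have "I n \<omega> = 0" if "m\<^sub>0 \<le> n" for n
        proof -
          \<comment> \<open>The inclusion delivers two facts at once: the pullback is a character,
            and it differs from the conjugate of \<gamma>.\<close>
          have "adjoint_map (comp_upto \<omega> n) \<delta> \<in> dual_group - {\<lambda>x. cnj (\<gamma> x)}"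
            using m\<^sub>0[OF that] \<delta> False by (auto simp: trivial_character_def)
          then have c: "(\<lambda>x. \<delta> (comp_upto \<omega> n x)) \<in> dual_group" "(\<lambda>x. \<delta> (comp_upto \<omega> n x)) \<noteq> (\<lambda>x. cnj (\<gamma> x))"
            by (auto simp: adjoint_map_def comp_def)
          have "(\<lambda>x. \<gamma> x * \<delta> (comp_upto \<omega> n x)) \<noteq> (\<lambda>_. 1)"
          proof
            assume eq: "(\<lambda>x. \<gamma> x * \<delta> (comp_upto \<omega> n x)) = (\<lambda>_. 1)"
            have "\<delta> (comp_upto \<omega> n x) = cnj (\<gamma> x)" for x
            proof -
              have "cnj (\<gamma> x) * \<gamma> x = 1"
                using complex_norm_square[of "\<gamma> x"] dual_groupD(2)[OF \<gamma>, of x] by (simp add: mult.commute)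
              then have "\<delta> (comp_upto \<omega> n x) = cnj (\<gamma> x) * (\<gamma> x * \<delta> (comp_upto \<omega> n x))"
                by (simp flip: mult.assoc)
              then show ?thesis using fun_cong[OF eq, of x] by simp
            qed
            with c(2) show False by blast
          qed
          then show ?thesis
            unfolding I_def by (intro integral_character dual_group_mult \<gamma> c(1))
        qed
        then show "(\<lambda>n. b n \<omega> * I n \<omega>) \<longlonglongrightarrow> 0"
          by (intro tendsto_eventually eventually_sequentiallyI[of m\<^sub>0]) simp
      qed
    qed (simp_all add: bI_meas)
    then show ?thesis
      unfolding correlations_decay_def corr elem_integral[OF B \<delta>] integral_character[OF \<delta> False] by simp
  qed
qed

text \<open>Density is used one argument at a time: \<open>F\<close> is reduced to an elementary
  function for a fixed arbitrary \<open>H\<close>, and only then is \<open>H\<close>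
  reduced.\<close>

lemma skew_product_mixing:
  assumes "fourier_tight \<mu>" "strongly_mixing \<mu> seq_shift"
  shows "strongly_mixing (\<mu> \<Otimes>\<^sub>M m) skew_product"
proof -
  let ?\<nu> = "\<mu> \<Otimes>\<^sub>M m"
  note inv = skew_product_invariant
  have "correlations_decay ?\<nu> skew_product F H" if F: "in_L2 ?\<nu> F" and H: "in_L2 ?\<nu> H" for F H
  proof (rule L2_induct_elementary[OF F, where P="\<lambda>F. correlations_decay ?\<nu> skew_product F H"])
    fix A and \<gamma> :: "'a \<Rightarrow> complex"
    assume A: "A \<in> sets \<mu>" and \<gamma>: "\<gamma> \<in> dual_group"
    have e: "in_L2 ?\<nu> (elementary A \<gamma>)" by (rule elementary_in_L2[OF A dual_groupD(1)[OF \<gamma>]])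
    show "correlations_decay ?\<nu> skew_product (elementary A \<gamma>) H"
    proof (rule L2_induct_elementary[OF H, where P="correlations_decay ?\<nu> skew_product (elementary A \<gamma>)"])
      show "correlations_decay ?\<nu> skew_product (elementary A \<gamma>) (elementary B \<delta>)"
        if "B \<in> sets \<mu>" "\<delta> \<in> dual_group" for B \<delta>
        by (rule decay_elementary[OF A that(1) \<gamma> that(2) assms])
      fix f
      assume "in_L2 ?\<nu> f" "\<And>e. 0 < e \<Longrightarrow> \<exists>g. in_L2 ?\<nu> g \<and>
        correlations_decay ?\<nu> skew_product (elementary A \<gamma>) g \<and> sq_norm ?\<nu> (\<lambda>x. f x - g x) < e"
      then show "correlations_decay ?\<nu> skew_product (elementary A \<gamma>) f"
        by (rule decay_lim_right[OF inv e])
    qed (rule decay_add_right[OF inv _ _ e] decay_cmult_right[OF inv], assumption+)+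
  next
    fix f
    assume "in_L2 ?\<nu> f" "\<And>e. 0 < e \<Longrightarrow> \<exists>g. in_L2 ?\<nu> g \<and>
      correlations_decay ?\<nu> skew_product g H \<and> sq_norm ?\<nu> (\<lambda>x. f x - g x) < e"
    then show "correlations_decay ?\<nu> skew_product f H"
      by (rule decay_lim_left[OF inv _ H])
  qed (rule decay_add_left[OF inv _ _ H] decay_cmult_left[OF inv], assumption+)+
  then show ?thesis
    using inv by (simp add: strongly_mixing_def correlations_decay_def)
qed

end

theorem theorem4p3:
  fixes m :: "'a::{topological_ab_group_add, t2_space} measure"
    and \<mu> :: "(nat \<Rightarrow> 'a \<Rightarrow> 'a) measure"
  assumes "compact (UNIV :: 'a set)"
    and "countable (dual_group :: ('a \<Rightarrow> complex) set)"
    and "haar_probability m"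
    and "space \<mu> = {\<omega>. \<forall>n. \<omega> n \<in> Epi}"
    and "seq_shift \<in> measurable \<mu> \<mu>"
    and "(\<lambda>(\<omega>, x). \<omega> 0 x) \<in> measurable (\<mu> \<Otimes>\<^sub>M borel) borel"
    and "invariant_probability \<mu> seq_shift"
    and "fourier_tight \<mu>"
    and "strongly_mixing \<mu> seq_shift"
  shows "strongly_mixing (\<mu> \<Otimes>\<^sub>M m) skew_product"
proof -
  interpret epimorphism_skew_product m \<mu>
    by unfold_locales (use assms in auto)
  show ?thesis by (rule skew_product_mixing[OF assms(8,9)])
qed

end
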